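(* Let $d \geq 1$ be an integer. Let $X_1, X_2, \ldots$ be independent rotationally invariant random vectors in $\mathbb{R}^d$, each taking values almost surely in the closed unit Euclidean ball of $\mathbb{R}^d$. Let $G_1, G_2, \ldots$ be independent standard Gaussian random vectors in $\mathbb{R}^d$ (mean zero, identity covariance matrix). Then for every $m \geq 1$, all real numbers $a_1, \ldots, a_m$ and every $t > 0$, \[ \mathbb{P}\left(\left\|\sum_{i=1}^m a_i X_i\right\| > t\right) \leq 397 \cdot \mathbb{P}\left(\left\|\sum_{i=1}^m a_i \frac{G_i}{\sqrt{d}}\right\| > t\right). \]
   Context: $\|\cdot\|$ denotes the standard Euclidean norm on $\mathbb{R}^d$. A random vector $X$ in $\mathbb{R}^d$ is rotationally invariant if $UX$ has the same distribution as $X$ for every orthogonal $d\times d$ matrix $U$. *)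

theory Defs
  imports "HOL-Probability.Probability"
begin

definition rot_invariant :: "'a measure \<Rightarrow> ('a \<Rightarrow> real^'d) \<Rightarrow> bool" where
  "rot_invariant M X \<longleftrightarrow>
     (\<forall>U::real^'d^'d. orthogonal_matrix U \<longrightarrow>
        distr M borel (\<lambda>\<omega>. U *v X \<omega>) = distr M borel X)"

definition std_gaussian_vector :: "'a measure \<Rightarrow> ('a \<Rightarrow> real^'d) \<Rightarrow> bool" where
  "std_gaussian_vector M G \<longleftrightarrow>
     G \<in> borel_measurable M \<and>
     prob_space.indep_vars M (\<lambda>_. borel) (\<lambda>j \<omega>. G \<omega> $ j) (UNIV :: 'd set) \<and>
     (\<forall>j. distributed M lborel (\<lambda>\<omega>. G \<omega> $ j) std_normal_density)"

end

theory Submission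
  imports Defs
begin

text \<open>
  For \<open>\<phi> s = (max 0 (s - u))\<^sup>5\<close> the function \<open>r \<mapsto> \<phi> (A + B r\<^sup>2 + c r)\<close> has nonnegative fourth
  derivative, so its even part is convex and increasing as a function of \<open>r\<^sup>2\<close>. Writing a rotationally
  invariant vector as its norm times an independent uniform direction, and pairing opposite directions,
  Jensen's inequality for \<open>\<bar>G\<bar>\<^sup>2 / d\<close>, which has mean \<open>1\<close>, allows the vectors \<open>X\<^sub>i\<close> to be replaced one at
  a time by \<open>G\<^sub>i / sqrt d\<close>, increasing the moment \<open>E \<phi> (\<bar>\<Sum> a\<^sub>i X\<^sub>i\<bar>\<^sup>2)\<close>. The Gaussian sum is isotropic, and
  its squared norm has a Gamma density of shape \<open>d / 2\<close>. For \<open>d \<ge> 2\<close> this density is log-concave, and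
  comparing it with the exponential through two of its points shows that Markov's inequality with
  a suitable \<open>u\<close> loses only a constant factor. For \<open>d = 1\<close> the density is decreasing and explicit
  estimates suffice.
\<close>

subsection \<open>Hinge functions along a line\<close>

text \<open>For a single direction the linear term \<open>c * r\<close> can destroy convexity in
  \<open>r\<^sup>2\<close>; only the sum over the two opposite directions is convex. That convexity
  amounts to n'(r)/r being nondecreasing, which holds once n' is convex on r \<ge> 0 with n'(0) = 0.
  This is where the sign of the fourth derivative enters, and five is the least exponent of the
  hinge for which that derivative exists everywhere. The families X and G need not be independent of
  each other, so a sum mixing both is never evaluated at one sample point: mixed expectations are
  iterated integrals over two copies of M. Nonnegative integrals are used throughout, so no
  integrability has to be established. The hinge position u is tied to the length over which the
  Gaussian tail decays beyond t^2; the loss then depends neither on the dimension nor on the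
  coefficients. The constant 397 leaves room: the estimates below need less than 31 for d \<ge> 2,
  and for d = 1 at most 203 when t^2 is large against the scale and 330 otherwise.\<close>

lemma DERIV_max_0_power:
  fixes x :: real
  shows "((\<lambda>x. max 0 x ^ Suc (Suc n)) has_real_derivative real (Suc (Suc n)) * max 0 x ^ Suc n) (at x)"
proof (cases x "0::real" rule: linorder_cases)
  case less
  have "((\<lambda>x::real. 0) has_real_derivative 0) (at x)"
    by simp
  then have "((\<lambda>x. max 0 x ^ Suc (Suc n)) has_real_derivative 0) (at x)"
    by (rule has_field_derivative_transform_within_open[where S = "{..<0}"]) (use less in auto)
  then show ?thesis
    using less by simp
next
  case equal
  \<comment> \<open>At the kink Caratheodory's criterion applies: the slope function
    \<open>max 0 z ^ Suc n\<close> is continuous and vanishes at 0, because its exponent is at least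
    one.\<close>
  have "max 0 z ^ Suc (Suc n) - max 0 x ^ Suc (Suc n) = max 0 z ^ Suc n * (z - x)" for z :: real
    using equal by (cases "z \<le> 0") auto
  moreover have "isCont (\<lambda>z. max 0 z ^ Suc n) x"
    by (intro continuous_intros)
  moreover have "max 0 x ^ Suc n = real (Suc (Suc n)) * max 0 x ^ Suc n"
    using equal by simp
  ultimately show ?thesis
    unfolding CARAT_DERIV by (intro exI[of _ "\<lambda>z. max 0 z ^ Suc n"] conjI allI)
next
  case greater
  have "((\<lambda>x. x ^ Suc (Suc n)) has_real_derivative real (Suc (Suc n)) * x ^ Suc n) (at x)"
    using DERIV_pow[of "Suc (Suc n)" x] by simp
  then have "((\<lambda>x. max 0 x ^ Suc (Suc n)) has_real_derivative real (Suc (Suc n)) * x ^ Suc n) (at x)"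
    by (rule has_field_derivative_transform_within_open[where S = "{0<..}"]) (use greater in auto)
  then show ?thesis
    using greater by simp
qed

lemma DERIV_max_0_power_chain:
  assumes "(q has_real_derivative D) (at x)"
  shows "((\<lambda>x. max 0 (q x) ^ Suc (Suc n)) has_real_derivative
    real (Suc (Suc n)) * max 0 (q x) ^ Suc n * D) (at x)"
  using DERIV_chain2[OF DERIV_max_0_power assms] .

text \<open>The derivative n' is odd, so it vanishes at 0, and it is convex on r \<ge> 0. Hence
  n'(r)/r is nondecreasing, n is a convex function of \<open>r\<^sup>2\<close>, and its tangent at
  \<open>r\<^sup>2\<close> = 1 has slope k = n'(1)/2. The support inequality is arranged without
  subtraction so that it carries over to \<open>ennreal\<close>, where it serves as Jensen's
  inequality.\<close>

lemma even_part_support_line: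
  fixes A B c :: real
  assumes "B \<ge> 0"
  defines "n \<equiv> \<lambda>r. max 0 (A + B * r\<^sup>2 + c * r) ^ 5 + max 0 (A + B * r\<^sup>2 - c * r) ^ 5"
  obtains k where "k \<ge> 0" "\<And>r. r \<ge> 0 \<Longrightarrow> n 1 + k * r\<^sup>2 \<le> n r + k" "\<And>r. 0 \<le> r \<Longrightarrow> r \<le> 1 \<Longrightarrow> n r \<le> n 1"
proof -
  define q where "q = (\<lambda>r. A + B * r\<^sup>2 + c * r)"
  define q' where "q' = (\<lambda>r. 2 * B * r + c)"
  define P where "P = (\<lambda>j r. max 0 (q r) ^ j)"
  have dq: "(q has_real_derivative q' r) (at r)" for r
    unfolding q_def q'_def by (auto intro!: derivative_eq_intros)
  have dq': "(q' has_real_derivative 2 * B) (at r)" for r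
    unfolding q'_def by (auto intro!: derivative_eq_intros)
  have dP: "(P (Suc (Suc j)) has_real_derivative real (Suc (Suc j)) * P (Suc j) r * q' r) (at r)" for j r
    unfolding P_def by (rule DERIV_max_0_power_chain[OF dq])
  have P_nonneg: "P j r \<ge> 0" for j r
    by (simp add: P_def)
  note dP5 = dP[of 3, simplified] and dP4 = dP[of 2, simplified] and dP3 = dP[of 1, simplified]
    and dP2 = dP[of 0, simplified]
  \<comment> \<open>\<open>h1\<close> to \<open>h4\<close> are the successive derivatives of
    \<open>P 5\<close>. In \<open>h2\<close> and \<open>h4\<close> only even powers of
    \<open>q'\<close> occur, with coefficients nonnegative for B \<ge> 0, so these two have a sign;
    \<open>h1\<close> and \<open>h3\<close> need not.\<close>
  define h1 where "h1 = (\<lambda>r. 5 * P 4 r * q' r)"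
  define h2 where "h2 = (\<lambda>r. 20 * P 3 r * (q' r)\<^sup>2 + 10 * B * P 4 r)"
  define h3 where "h3 = (\<lambda>r. 60 * P 2 r * q' r ^ 3 + 120 * B * P 3 r * q' r)"
  define h4 where "h4 = (\<lambda>r. 120 * P 1 r * q' r ^ 4 + 720 * B * P 2 r * (q' r)\<^sup>2 + 240 * B\<^sup>2 * P 3 r)"
  have d1: "(P 5 has_real_derivative h1 r) (at r)" for r
    using dP5[of r] by (simp add: h1_def eval_nat_numeral)
  have d2: "(h1 has_real_derivative h2 r) (at r)" for r
    unfolding h1_def h2_def using dP4[of r]
    by (auto intro!: derivative_eq_intros dq' simp: eval_nat_numeral algebra_simps)
  have d3: "(h2 has_real_derivative h3 r) (at r)" for r
    unfolding h2_def h3_def using dP4[of r] dP3[of r]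
    by (auto intro!: derivative_eq_intros dq' simp: eval_nat_numeral algebra_simps)
  have d4: "(h3 has_real_derivative h4 r) (at r)" for r
    unfolding h3_def h4_def using dP3[of r] dP2[of r]
    by (auto intro!: derivative_eq_intros dq' simp: eval_nat_numeral algebra_simps)
  have h2_nonneg: "h2 r \<ge> 0" and h4_nonneg: "h4 r \<ge> 0" for r
    using \<open>B \<ge> 0\<close> P_nonneg by (auto simp: h2_def h4_def)
  have n_eq: "n = (\<lambda>r. P 5 r + P 5 (- r))"
    by (simp add: n_def P_def q_def)
  define n1 where "n1 = (\<lambda>r. h1 r - h1 (- r))"
  define n2 where "n2 = (\<lambda>r. h2 r + h2 (- r))"
  define n3 where "n3 = (\<lambda>r. h3 r - h3 (- r))"
  have dn: "(n has_real_derivative n1 r) (at r)" for r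
    unfolding n_eq n1_def by (rule derivative_eq_intros d1 DERIV_chain2[OF d1] refl | simp)+
  have dn1: "(n1 has_real_derivative n2 r) (at r)" for r
    unfolding n1_def n2_def by (rule derivative_eq_intros d2 DERIV_chain2[OF d2] refl | simp)+
  have dn2: "(n2 has_real_derivative n3 r) (at r)" for r
    unfolding n2_def n3_def by (rule derivative_eq_intros d3 DERIV_chain2[OF d3] refl | simp)+
  have n3_nonneg: "n3 r \<ge> 0" if "r \<ge> 0" for r
  proof -
    have "h3 (- r) \<le> h3 r"
      by (rule DERIV_nonneg_imp_nondecreasing[of _ _ h3]) (use that d4 h4_nonneg in auto)
    then show ?thesis
      by (simp add: n3_def)
  qed
  have n1_0: "n1 0 = 0"
    by (simp add: n1_def)
  have n1_nonneg: "n1 r \<ge> 0" if "r \<ge> 0" for r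
  proof -
    have "n1 0 \<le> n1 r"
      by (rule DERIV_nonneg_imp_nondecreasing[of 0 r n1])
        (use that dn1 h2_nonneg in \<open>force simp: n2_def\<close>)+
    then show ?thesis
      by (simp add: n1_0)
  qed
  have "convex_on {0..} n1"
    by (rule f''_ge0_imp_convex[of _ _ n2 n3]) (use dn1 dn2 n3_nonneg in auto)
  \<comment> \<open>Convexity between 0 and r together with \<open>n1 0 = 0\<close>: this is the
    monotonicity of n'(r)/r without the division.\<close>
  then have n1_scale: "n1 (u * r) \<le> u * n1 r" if "0 \<le> u" "u \<le> 1" "r \<ge> 0" for u r
    using convex_onD[of "{0..}" n1 u 0 r] that by (simp add: n1_0)
  \<comment> \<open>The subtracted parabola has the same slope as n at r = 1, so D' changes sign
    there from nonpositive to nonnegative and D is minimal at 1.\<close>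
  define D where "D = (\<lambda>r. n r - n1 1 / 2 * r\<^sup>2)"
  have dD: "(D has_real_derivative n1 r - n1 1 * r) (at r)" for r
    unfolding D_def by (auto intro!: derivative_eq_intros dn)
  have D_ge: "D 1 \<le> D r" if "r \<ge> 0" for r
  proof (cases "r \<le> 1")
    case True
    show ?thesis
    proof (rule DERIV_nonpos_imp_nonincreasing[OF True])
      fix x assume "r \<le> x" "x \<le> 1"
      then have "n1 x - n1 1 * x \<le> 0"
        using n1_scale[of x 1] that by (simp add: mult.commute)
      then show "\<exists>y. DERIV D x :> y \<and> y \<le> 0"
        using dD by blast
    qed
  next
    case False
    then have "1 \<le> r" by simp
    then show ?thesis
    proof (rule DERIV_nonneg_imp_nondecreasing)
      fix x assume "1 \<le> x" "x \<le> r"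
      then have "n1 x - n1 1 * x \<ge> 0"
        using n1_scale[of "1 / x" x] by (simp add: field_simps)
      then show "\<exists>y. DERIV D x :> y \<and> y \<ge> 0"
        using dD by blast
    qed
  qed
  show ?thesis
  proof (rule that)
    show "n1 1 / 2 \<ge> 0"
      using n1_nonneg[of 1] by simp
    show "n 1 + n1 1 / 2 * r\<^sup>2 \<le> n r + n1 1 / 2" if "r \<ge> 0" for r
      using D_ge[OF that] by (simp add: D_def)
    show "n r \<le> n 1" if "0 \<le> r" "r \<le> 1" for r
      by (rule DERIV_nonneg_imp_nondecreasing[OF \<open>r \<le> 1\<close>]) (use that dn n1_nonneg order_trans in blast)
  qed
qed

subsection \<open>Lebesgue measure under rotations and in polar form\<close>

lemma nn_integral_lborel_translation:
  fixes c :: "'a::euclidean_space"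
  assumes "f \<in> borel_measurable borel"
  shows "(\<integral>\<^sup>+x. f (c + x) \<partial>lborel) = (\<integral>\<^sup>+x. f x \<partial>lborel)"
proof -
  have "(\<integral>\<^sup>+x. f x \<partial>lborel) = (\<integral>\<^sup>+x. f x \<partial>distr lborel borel ((+) c))"
    by (simp add: lborel_distr_plus)
  also have "\<dots> = (\<integral>\<^sup>+x. f (c + x) \<partial>lborel)"
    by (rule nn_integral_distr) (use assms in auto)
  finally show ?thesis ..
qed

text \<open>The uniqueness argument for Haar measure, with the indicator of a ball as reference function.\<close>

lemma nn_integral_lborel_orthogonal:
  fixes f :: "'a::euclidean_space \<Rightarrow> 'a"
  assumes f: "orthogonal_transformation f" and g [measurable]: "g \<in> borel_measurable borel"
  shows "(\<integral>\<^sup>+x. g (f x) \<partial>lborel) = (\<integral>\<^sup>+x. g x \<partial>lborel)"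
proof -
  have "linear f" and norm_f: "\<And>x. norm (f x) = norm x"
    using f by (auto simp: orthogonal_transformation_linear orthogonal_transformation_norm)
  then have [measurable]: "f \<in> borel_measurable borel"
    by (intro borel_measurable_continuous_onI linear_continuous_on)
      (simp add: linear_conv_bounded_linear)
  define k :: "'a \<Rightarrow> ennreal" where "k = indicator (cball 0 1)"
  have [measurable]: "k \<in> borel_measurable borel"
    unfolding k_def by (intro borel_measurable_indicator) auto
  define V where "V = (\<integral>\<^sup>+x. k x \<partial>lborel)"
  have V: "V = ennreal (unit_ball_vol (real DIM('a)))"
    unfolding V_def k_def by (simp add: emeasure_cball)
  have "(\<integral>\<^sup>+x. g (f x) \<partial>lborel) * V = (\<integral>\<^sup>+x. g (f x) * (\<integral>\<^sup>+y. k (y - f x) \<partial>lborel) \<partial>lborel)"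
    using nn_integral_lborel_translation[of k "- f x" for x]
    by (simp add: V_def nn_integral_multc)
  also have "\<dots> = (\<integral>\<^sup>+x. \<integral>\<^sup>+y. g (f x) * k (y - f x) \<partial>lborel \<partial>lborel)"
    by (simp add: nn_integral_cmult)
  also have "\<dots> = (\<integral>\<^sup>+y. \<integral>\<^sup>+x. g (f x) * k (y - f x) \<partial>lborel \<partial>lborel)"
    by (rule lborel_pair.Fubini') simp
  also have "\<dots> = (\<integral>\<^sup>+y. \<integral>\<^sup>+x. g (y + f x) * k x \<partial>lborel \<partial>lborel)"
  proof (rule nn_integral_cong)
    fix y
    \<comment> \<open>Translating x by the preimage z of y turns \<open>k (y - f x)\<close> into
      \<open>k (- f x)\<close>, which equals \<open>k x\<close> because the unit ball is preserved
      by f and by negation.\<close>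
    obtain z where z: "f z = y"
      using orthogonal_transformation_surj[OF f] by (metis surjD)
    have "(\<integral>\<^sup>+x. g (f x) * k (y - f x) \<partial>lborel) = (\<integral>\<^sup>+x. g (f (z + x)) * k (y - f (z + x)) \<partial>lborel)"
      by (rule nn_integral_lborel_translation[symmetric]) simp
    also have "\<dots> = (\<integral>\<^sup>+x. g (y + f x) * k x \<partial>lborel)"
      using norm_f by (intro nn_integral_cong) (simp add: linear_add[OF \<open>linear f\<close>] z k_def indicator_def)
    finally show "(\<integral>\<^sup>+x. g (f x) * k (y - f x) \<partial>lborel) = (\<integral>\<^sup>+x. g (y + f x) * k x \<partial>lborel)" .
  qed
  also have "\<dots> = (\<integral>\<^sup>+x. \<integral>\<^sup>+y. g (y + f x) * k x \<partial>lborel \<partial>lborel)"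
    by (rule lborel_pair.Fubini') simp
  also have "\<dots> = (\<integral>\<^sup>+x. (\<integral>\<^sup>+y. g y \<partial>lborel) * k x \<partial>lborel)"
    using nn_integral_lborel_translation[OF g, of "f x" for x]
    by (simp add: nn_integral_multc add.commute)
  also have "\<dots> = (\<integral>\<^sup>+x. g x \<partial>lborel) * V"
    by (simp add: nn_integral_cmult V_def)
  finally have "(\<integral>\<^sup>+x. g (f x) \<partial>lborel) * V = (\<integral>\<^sup>+x. g x \<partial>lborel) * V" .
  moreover have "\<not> unit_ball_vol (real DIM('a)) \<le> 0"
    by (simp add: not_le)
  ultimately show ?thesis
    by (simp add: V mult_right_ennreal_cancel)
qed

text \<open>A measure on the line that is finite on half-lines is determined by its values there.
  Those values are volumes of balls of radius \<open>sqrt w\<close>, and the density is their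
  derivative in w. No surface measure on the sphere is required.\<close>

lemma distr_lborel_norm_squared:
  "distr lborel borel (\<lambda>x::'a::euclidean_space. (norm x)\<^sup>2) =
    density lborel (\<lambda>w. ennreal (unit_ball_vol (real DIM('a)) * (DIM('a) / 2) * w powr (DIM('a) / 2 - 1)) * indicator {0..} w)"
    (is "?L = ?R")
proof (rule measure_eqI_generator_eq[where E = "range atMost" and \<Omega> = UNIV and A = "\<lambda>n. {..real n}"])
  let ?V = "unit_ball_vol (real DIM('a))"
  have pos: "real DIM('a) > 0" by simp
  have eL: "emeasure ?L {..w} = (if w \<ge> 0 then ennreal (?V * w powr (DIM('a) / 2)) else 0)" for w
  proof -
    have "emeasure ?L {..w} = emeasure lborel {x::'a. (norm x)\<^sup>2 \<le> w}"
      by (subst emeasure_distr) (auto simp: vimage_def)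
    also have "\<dots> = (if w \<ge> 0 then ennreal (?V * w powr (DIM('a) / 2)) else 0)"
    proof (cases "w \<ge> 0")
      case True
      then have "{x::'a. (norm x)\<^sup>2 \<le> w} = cball 0 (sqrt w)"
        by (auto simp: real_le_rsqrt real_sqrt_le_iff abs_le_square_iff intro: sqrt_le_D real_le_lsqrt)
          (metis norm_ge_zero real_sqrt_le_iff real_sqrt_pow2 real_sqrt_power sqrt_le_D)
      moreover have "sqrt w ^ DIM('a) = w powr (DIM('a) / 2)"
        using True by (cases "w = 0") (auto simp: powr_half_sqrt[symmetric] powr_powr powr_realpow[symmetric])
      ultimately show ?thesis
        using True by (simp add: emeasure_cball)
    next
      case False
      then have "{x::'a. (norm x)\<^sup>2 \<le> w} = {}"
        by (auto simp: not_le intro: less_le_trans)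
      then show ?thesis using False by simp
    qed
    finally show ?thesis .
  qed
  have eR: "emeasure ?R {..w} = (if w \<ge> 0 then ennreal (?V * w powr (DIM('a) / 2)) else 0)" for w
  proof -
    have eq: "emeasure ?R {..w} = (\<integral>\<^sup>+x. ennreal (?V * (DIM('a) / 2) * (x powr (DIM('a) / 2 - 1) * indicator {0..w} x)) \<partial>lborel)"
      by (subst emeasure_density) (auto intro!: nn_integral_cong split: split_indicator)
    show ?thesis
    proof (cases "w \<ge> 0")
      case True
      have "((\<lambda>x. x powr (DIM('a) / 2 - 1)) has_integral (w powr (DIM('a) / 2) / (DIM('a) / 2))) {0..w}"
        using has_integral_powr_from_0[of "DIM('a) / 2 - 1" w] True by simp
      then have "((\<lambda>x. x powr (DIM('a) / 2 - 1) * indicator {0..w} x) has_integral (w powr (DIM('a) / 2) / (DIM('a) / 2))) UNIV"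
        by (subst (asm) has_integral_restrict_UNIV[symmetric]) (simp add: indicator_def of_bool_def if_distrib cong: if_cong)
      then have "((\<lambda>x. ?V * (DIM('a) / 2) * (x powr (DIM('a) / 2 - 1) * indicator {0..w} x)) has_integral
          (?V * (DIM('a) / 2) * (w powr (DIM('a) / 2) / (DIM('a) / 2)))) UNIV"
        by (rule has_integral_mult_right)
      then show ?thesis
        unfolding eq using True by (subst nn_integral_has_integral_lborel) (auto simp: unit_ball_vol_nonneg)
    next
      case False
      then show ?thesis
        unfolding eq by simp
    qed
  qed
  show "emeasure ?L X = emeasure ?R X" if "X \<in> range atMost" for X
    using that eL eR by auto
  show "emeasure ?L {..real i} \<noteq> \<infinity>" for i
    using eL by simp
  show "(\<Union>i. {..real i}) = UNIV"
    using real_arch_simple by auto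
qed (auto simp: Int_stable_def borel_eq_atMost sets_measure_of intro: range_eqI[where x="min a b" for a b])

subsection \<open>Tails of the Gamma density\<close>

text \<open>The substitution w = u + x/b reduces this to the factorial integral. Every exponential
  majorant in the tail estimates has this shape, with k = 5 for a hinge moment and k = 0 for a total
  mass.\<close>

lemma nn_integral_shifted_gamma:
  fixes b C u :: real
  assumes "b > 0" "C \<ge> 0"
  shows "(\<integral>\<^sup>+w. ennreal ((w - u) ^ k * (C * exp (- b * (w - u)))) * indicator {u..} w \<partial>lborel)
    = ennreal (fact k * C / b ^ Suc k)"
proof -
  have "(\<integral>\<^sup>+w. ennreal ((w - u) ^ k * (C * exp (- b * (w - u)))) * indicator {u..} w \<partial>lborel)
      = ennreal \<bar>1 / b\<bar> * (\<integral>\<^sup>+x. ennreal ((u + 1 / b * x - u) ^ k * (C * exp (- b * (u + 1 / b * x - u))))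
          * indicator {u..} (u + 1 / b * x) \<partial>lborel)"
    by (rule nn_integral_real_affine) (use assms in auto)
  also have "\<dots> = ennreal (1 / b) * (\<integral>\<^sup>+x. ennreal (C / b ^ k) * (ennreal (x ^ k * exp (- x)) * indicator {0..} x) \<partial>lborel)"
  proof -
    have "ennreal ((u + 1 / b * x - u) ^ k * (C * exp (- b * (u + 1 / b * x - u)))) * indicator {u..} (u + 1 / b * x)
        = ennreal (C / b ^ k) * (ennreal (x ^ k * exp (- x)) * indicator {0..} x)" for x
      using assms by (cases "x \<ge> 0")
        (auto simp: ennreal_mult'[symmetric] power_divide zero_le_divide_iff field_simps split: split_indicator)
    then show ?thesis
      using assms by simp
  qed
  also have "\<dots> = ennreal (1 / b) * (ennreal (C / b ^ k) * ennreal (fact k))"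
    using assms by (simp add: nn_integral_cmult nn_intergal_power_times_exp_Ici)
  also have "\<dots> = ennreal (fact k * C / b ^ Suc k)"
    using assms by (simp add: ennreal_mult'[symmetric] mult.commute)
  finally show ?thesis .
qed

text \<open>Concavity, obtained from the tangent at y, which lies above the graph by ln x \<le> x -
  1. Clearing denominators lets the three points coincide.\<close>

lemma gamma_log_density_chord:
  fixes \<alpha> \<beta> x y z :: real
  assumes "\<alpha> \<ge> 0" "0 < x" "x \<le> y" "y \<le> z"
  defines "l \<equiv> \<lambda>w. \<alpha> * ln w - \<beta> * w"
  shows "(z - y) * l x + (y - x) * l z \<le> (z - x) * l y"
proof -
  define D where "D = \<alpha> / y - \<beta>"
  have tangent: "l w \<le> l y + D * (w - y)" if "w > 0" for w
  proof -
    have "ln (w / y) \<le> w / y - 1"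
      using that assms by (intro ln_le_minus_one) simp
    then have "\<alpha> * (ln w - ln y) \<le> \<alpha> * (w / y - 1)"
      using that assms by (intro mult_left_mono) (auto simp: ln_div)
    moreover have "\<alpha> * (w / y - 1) = \<alpha> / y * (w - y)"
      using assms by (simp add: field_simps)
    ultimately show ?thesis
      by (simp add: l_def D_def algebra_simps)
  qed
  have "(z - y) * l x + (y - x) * l z
      \<le> (z - y) * (l y + D * (x - y)) + (y - x) * (l y + D * (z - y))"
    using assms by (intro add_mono mult_left_mono tangent) auto
  also have "\<dots> = (z - x) * l y"
    by (simp add: algebra_simps)
  finally show ?thesis .
qed

lemma exp_power_nat: "exp (real n) = exp 1 ^ n"
  by (metis exp_of_nat_mult mult.right_neutral)

text \<open>The log-density tends to minus infinity, so by continuity it falls by exactly one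
  somewhere beyond \<tau>. The distance to such a point measures how fast the tail decays at
  \<tau>.\<close>

lemma gamma_log_density_drop:
  fixes \<alpha> \<beta> \<tau> :: real
  assumes "\<alpha> \<ge> 0" "\<beta> > 0" "\<tau> > 0"
  obtains w where "w > \<tau>" "\<alpha> * ln w - \<beta> * w = \<alpha> * ln \<tau> - \<beta> * \<tau> - 1"
proof -
  define l where "l = (\<lambda>w. \<alpha> * ln w - \<beta> * w)"
  \<comment> \<open>This c makes \<alpha>/c at most \<beta>/2, so half of the linear term absorbs
    the logarithm; the summand 1 keeps c positive when \<alpha> = 0.\<close>
  define c where "c = (2 * \<alpha> + 1) / \<beta>"
  have "c > 0"
    using assms by (simp add: c_def)
  have le: "l w \<le> \<alpha> * ln c - \<beta> / 2 * w" if "w > 0" for w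
  proof -
    have "ln (w / c) \<le> w / c - 1"
      using that \<open>c > 0\<close> by (intro ln_le_minus_one) simp
    then have "\<alpha> * (ln w - ln c) \<le> \<alpha> * (w / c)"
      using that \<open>c > 0\<close> assms by (intro mult_left_mono) (auto simp: ln_div)
    also have "\<dots> \<le> \<beta> / 2 * w"
      using assms that by (simp add: c_def field_simps)
    finally show ?thesis
      by (simp add: l_def algebra_simps)
  qed
  define z where "z = max \<tau> (2 / \<beta> * (\<alpha> * ln c - (l \<tau> - 1)))"
  have "z \<ge> \<tau>" "z > 0"
    using assms by (auto simp: z_def)
  have "\<beta> / 2 * z \<ge> \<beta> / 2 * (2 / \<beta> * (\<alpha> * ln c - (l \<tau> - 1)))"
    using assms by (intro mult_left_mono) (auto simp: z_def)
  then have "\<beta> / 2 * z \<ge> \<alpha> * ln c - (l \<tau> - 1)"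
    using assms by simp
  then have "l z \<le> l \<tau> - 1"
    using le[OF \<open>z > 0\<close>] by simp
  moreover have "continuous_on {\<tau>..z} l"
    unfolding l_def using assms by (intro continuous_intros) auto
  ultimately obtain w where "\<tau> \<le> w" "w \<le> z" "l w = l \<tau> - 1"
    using IVT2'[of l z "l \<tau> - 1" \<tau>] \<open>z \<ge> \<tau>\<close> by auto
  then show ?thesis
    by (intro that[of w]) (cases "w = \<tau>", auto simp: l_def)
qed

text \<open>With L the distance over which the log-density drops by one, concavity works twice: on
  \<open>{\<tau>..w1}\<close> the density is at least its value at \<tau> divided by e, which bounds
  the tail from below; elsewhere it lies under the exponential of rate 1/L through the two
  endpoints, which bounds the hinge moment from above. Both bounds scale with L, so their ratio is
  an absolute constant.\<close>

lemma gamma_hinge_tail_log_concave: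
  fixes \<alpha> \<beta> \<tau> :: real
  assumes "\<alpha> \<ge> 0" "\<beta> > 0" "\<tau> > 0"
  defines "p \<equiv> \<lambda>w. ennreal (w powr \<alpha> * exp (- \<beta> * w)) * indicator {0..} w"
  shows "\<exists>u<\<tau>. (\<integral>\<^sup>+w. ennreal (max 0 (w - u) ^ 5) * p w \<partial>lborel)
    \<le> ennreal (397 * (\<tau> - u) ^ 5) * (\<integral>\<^sup>+w. p w * indicator {\<tau><..} w \<partial>lborel)"
proof -
  define l where "l = (\<lambda>w. \<alpha> * ln w - \<beta> * w)"
  have p_eq: "p w = (if w > 0 then ennreal (exp (l w)) else 0)" for w
    by (cases "w = 0") (auto simp: p_def l_def powr_def exp_add[symmetric])
  have [measurable]: "p \<in> borel_measurable borel"
    unfolding p_def by measurable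
  obtain w1 where w1: "w1 > \<tau>" "l w1 = l \<tau> - 1"
    using gamma_log_density_drop[OF assms(1-3)] unfolding l_def by blast
  define L where "L = w1 - \<tau>"
  have "L > 0"
    using w1 by (simp add: L_def)
  define Q where "Q = (\<integral>\<^sup>+w. p w * indicator {\<tau><..} w \<partial>lborel)"
  have chord: "(z - y) * l x + (y - x) * l z \<le> (z - x) * l y" if "0 < x" "x \<le> y" "y \<le> z" for x y z
    unfolding l_def by (rule gamma_log_density_chord) (use that \<open>\<alpha> \<ge> 0\<close> in auto)
  have inside: "l \<tau> - 1 \<le> l w" if "\<tau> \<le> w" "w \<le> w1" for w
  proof -
    have "L * (l \<tau> - 1) \<le> (w1 - w) * l \<tau> + (w - \<tau>) * l w1"
      using that by (simp add: L_def w1 algebra_simps)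
    also have "\<dots> \<le> L * l w"
      using chord[of \<tau> w w1] that \<open>\<tau> > 0\<close> by (simp add: L_def)
    finally show ?thesis
      using \<open>L > 0\<close> by simp
  qed
  \<comment> \<open>A concave function lies below the prolongation of its chord on either side of
    the two chosen points.\<close>
  have outside: "l w \<le> l \<tau> - (w - \<tau>) / L" if "w > 0" "w \<le> \<tau> \<or> w1 \<le> w" for w
  proof -
    have "L * l w \<le> L * l \<tau> - (w - \<tau>)"
      using that(2)
    proof
      assume "w \<le> \<tau>"
      then show ?thesis
        using chord[of w \<tau> w1] that(1) w1 by (simp add: L_def algebra_simps)
    next
      assume "w1 \<le> w"
      then show ?thesis
        using chord[of \<tau> w1 w] \<open>\<tau> > 0\<close> w1 by (simp add: L_def algebra_simps)
    qed
    then show ?thesis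
      using \<open>L > 0\<close> by (simp add: field_simps)
  qed
  have "ennreal (exp (l \<tau> - 1) * L) = (\<integral>\<^sup>+w. ennreal (exp (l \<tau> - 1)) * indicator {\<tau><..w1} w \<partial>lborel)"
    using w1 by (simp add: nn_integral_cmult_indicator L_def ennreal_mult')
  also have "\<dots> \<le> Q"
    unfolding Q_def using inside \<open>\<tau> > 0\<close>
    by (intro nn_integral_mono) (auto simp: p_eq split: split_indicator)
  finally have Q_ge: "ennreal (exp (l \<tau> - 1) * L) \<le> Q" .
  \<comment> \<open>\<open>1 / L\<close> plays the role of the hazard rate at \<open>\<tau>\<close>; for the exponential density of rate \<open>1 / L\<close> this \<open>u\<close> is optimal.\<close>
  define u where "u = \<tau> - 5 * L"
  \<comment> \<open>Only between \<tau> and \<open>w1\<close> can the exponential fail to dominate.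
    There w - u is less than 6 L, and that part is charged directly to the tail mass.\<close>
  have pointwise: "ennreal (max 0 (w - u) ^ 5) * p w \<le> ennreal ((6 * L) ^ 5) * (p w * indicator {\<tau><..} w)
      + ennreal ((w - u) ^ 5 * (exp (l \<tau> + 5) * exp (- (1 / L) * (w - u)))) * indicator {u..} w" for w
  proof (cases "w > 0 \<and> u < w")
    case False
    then show ?thesis
      by (auto simp: p_eq max_def)
  next
    case True
    show ?thesis
    proof (cases "\<tau> < w \<and> w < w1")
      case inner: True
      then have "max 0 (w - u) ^ 5 \<le> (6 * L) ^ 5"
        by (intro power_mono) (auto simp: u_def L_def)
      then have "ennreal (max 0 (w - u) ^ 5) * p w \<le> ennreal ((6 * L) ^ 5) * (p w * indicator {\<tau><..} w)"
        using inner by (auto simp del: power_mult_distrib intro!: mult_right_mono ennreal_leI)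
      then show ?thesis
        by (rule order_trans) simp
    next
      case False
      then have "l w \<le> l \<tau> - (w - \<tau>) / L"
        using outside[of w] True by auto
      also have "\<dots> = l \<tau> + 5 - 1 / L * (w - u)"
        using \<open>L > 0\<close> by (simp add: u_def field_simps)
      finally have "exp (l w) \<le> exp (l \<tau> + 5) * exp (- (1 / L) * (w - u))"
        by (simp add: exp_add[symmetric])
      then have "ennreal (max 0 (w - u) ^ 5) * p w \<le>
          ennreal ((w - u) ^ 5 * (exp (l \<tau> + 5) * exp (- (1 / L) * (w - u)))) * indicator {u..} w"
        using True by (auto simp: p_eq ennreal_mult'[symmetric] intro!: ennreal_leI mult_left_mono)
      then show ?thesis
        by (rule order_trans) simp
    qed
  qed
  have "(\<integral>\<^sup>+w. ennreal (max 0 (w - u) ^ 5) * p w \<partial>lborel)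
      \<le> ennreal ((6 * L) ^ 5) * Q + ennreal (fact 5 * exp (l \<tau> + 5) / (1 / L) ^ Suc 5)"
  proof -
    have "(\<integral>\<^sup>+w. ennreal (max 0 (w - u) ^ 5) * p w \<partial>lborel)
      \<le> (\<integral>\<^sup>+w. ennreal ((6 * L) ^ 5) * (p w * indicator {\<tau><..} w)
      + ennreal ((w - u) ^ 5 * (exp (l \<tau> + 5) * exp (- (1 / L) * (w - u)))) * indicator {u..} w \<partial>lborel)"
      by (intro nn_integral_mono pointwise)
    also have "\<dots> = ennreal ((6 * L) ^ 5) * Q + ennreal (fact 5 * exp (l \<tau> + 5) / (1 / L) ^ Suc 5)"
      using \<open>L > 0\<close> by (subst nn_integral_add)
        (auto simp: nn_integral_cmult Q_def nn_integral_shifted_gamma[of "1 / L" "exp (l \<tau> + 5)" u 5, simplified])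
    finally show ?thesis .
  qed
  \<comment> \<open>The factor \<open>exp 6\<close> compares the majorant at u, of height
    \<open>exp (l \<tau> + 5)\<close>, with the lower bound \<open>exp (l \<tau> - 1)\<close> on the
    density in the tail.\<close>
  also have "fact 5 * exp (l \<tau> + 5) / (1 / L) ^ Suc 5 = 120 * exp 6 * L ^ 5 * (exp (l \<tau> - 1) * L)"
  proof -
    have "exp (l \<tau> + 5) = exp 6 * exp (l \<tau> - 1)"
      by (simp add: exp_add[symmetric])
    then show ?thesis
      by (simp add: field_simps fact_numeral eval_nat_numeral)
  qed
  also have "ennreal (120 * exp 6 * L ^ 5 * (exp (l \<tau> - 1) * L)) \<le> ennreal (120 * exp 6 * L ^ 5) * Q"
    using Q_ge \<open>L > 0\<close> by (simp add: ennreal_mult' mult_left_mono)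
  also have "ennreal ((6 * L) ^ 5) * Q + ennreal (120 * exp 6 * L ^ 5) * Q
      = ennreal ((6 * L) ^ 5 + 120 * exp 6 * L ^ 5) * Q"
    using \<open>L > 0\<close> by (simp add: ennreal_plus distrib_right)
  also have "\<dots> \<le> ennreal (397 * (\<tau> - u) ^ 5) * Q"
  proof (intro mult_right_mono ennreal_leI)
    \<comment> \<open>After division by L^5 the claim is 6^5 + 120 * 3^6 = 95256 against 397 * 5^5 =
      1240625, so the crude bound e \<le> 3 suffices.\<close>
    have "exp (6::real) \<le> 3 ^ 6"
      using exp_power_nat[of 6] power_mono[OF exp_le, of 6] by simp
    then have "120 * exp 6 * L ^ 5 \<le> 120 * 3 ^ 6 * L ^ 5"
      using \<open>L > 0\<close> by (intro mult_right_mono) auto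
    then show "(6 * L) ^ 5 + 120 * exp 6 * L ^ 5 \<le> 397 * (\<tau> - u) ^ 5"
      using \<open>L > 0\<close> zero_le_power[of L 5] by (simp add: u_def power_mult_distrib)
  qed auto
  finally show ?thesis
    using \<open>L > 0\<close> by (intro exI[of _ u]) (auto simp: u_def Q_def add_left_mono)
qed

section \<open>The Gamma density of shape one half\<close>

lemma nn_integral_inverse_sqrt:
  assumes "b \<ge> 0"
  shows "(\<integral>\<^sup>+w. ennreal (w powr (- 1 / 2)) * indicator {0..b} w \<partial>lborel) = ennreal (2 * sqrt b)"
proof -
  have "((\<lambda>x. x powr (- 1 / 2)) has_integral (2 * sqrt b)) {0..b}"
    using has_integral_powr_from_0[of "- 1 / 2" b] assms by (simp add: powr_half_sqrt mult.commute)
  then have "((\<lambda>x. x powr (- 1 / 2) * indicator {0..b} x) has_integral (2 * sqrt b)) UNIV"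
    by (subst (asm) has_integral_restrict_UNIV[symmetric]) (simp add: indicator_def of_bool_def if_distrib cong: if_cong)
  then have "(\<integral>\<^sup>+w. ennreal (w powr (- 1 / 2) * indicator {0..b} w) \<partial>lborel) = ennreal (2 * sqrt b)"
    by (subst nn_integral_has_integral_lborel) auto
  then show ?thesis
    by (simp add: ennreal_mult'' ennreal_indicator)
qed

text \<open>For exponent -1/2 the log-density is convex, so chords bound it the wrong way. With b =
  1/\<beta> as length scale, the singular factor is nearly constant near \<tau> when \<tau> is at
  least 3 b, and an exponential comparison works; for smaller \<tau> the tail already carries a
  fixed share of the total mass, which is the first alternative.\<close>

lemma gamma_hinge_tail_half:
  fixes \<beta> \<tau> :: real
  assumes "\<beta> > 0" "\<tau> > 0"
  defines "p \<equiv> \<lambda>w. ennreal (w powr (- 1 / 2) * exp (- \<beta> * w)) * indicator {0..} w"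
  shows "(\<integral>\<^sup>+w. p w \<partial>lborel) \<le> 397 * (\<integral>\<^sup>+w. p w * indicator {\<tau><..} w \<partial>lborel) \<or>
    (\<exists>u<\<tau>. (\<integral>\<^sup>+w. ennreal (max 0 (w - u) ^ 5) * p w \<partial>lborel)
    \<le> ennreal (397 * (\<tau> - u) ^ 5) * (\<integral>\<^sup>+w. p w * indicator {\<tau><..} w \<partial>lborel))"
proof -
  define b where "b = 1 / \<beta>"
  have b: "b > 0" "\<beta> * b = 1"
    using assms(1,2) by (auto simp: b_def)
  define Q where "Q = (\<integral>\<^sup>+w. p w * indicator {\<tau><..} w \<partial>lborel)"
  have powr_half: "w powr (- 1 / 2) = 1 / sqrt w" if "w \<ge> 0" for w :: real
    using that powr_minus[of w "1 / 2"] by (simp add: powr_half_sqrt inverse_eq_divide)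
  have p_eq: "p w = (if w \<ge> 0 then ennreal (1 / sqrt w * exp (- \<beta> * w)) else 0)" for w
    unfolding p_def using powr_half by simp
  \<comment> \<open>The density decreases, so on the interval of length b after \<tau> it is at
    least its value at \<tau> + b.\<close>
  have Q_ge: "ennreal (b * (1 / sqrt (\<tau> + b) * exp (- \<beta> * \<tau> - 1))) \<le> Q"
  proof -
    have "ennreal (b * (1 / sqrt (\<tau> + b) * exp (- \<beta> * \<tau> - 1)))
        = (\<integral>\<^sup>+w. ennreal (1 / sqrt (\<tau> + b) * exp (- \<beta> * \<tau> - 1)) * indicator {\<tau><..\<tau> + b} w \<partial>lborel)"
      using b assms(1,2) by (subst nn_integral_cmult_indicator) (auto simp: ennreal_mult''[symmetric])
    also have "\<dots> \<le> Q"
      unfolding Q_def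
    proof (rule nn_integral_mono)
      fix w
      show "ennreal (1 / sqrt (\<tau> + b) * exp (- \<beta> * \<tau> - 1)) * indicator {\<tau><..\<tau> + b} w
          \<le> p w * indicator {\<tau><..} w"
      proof (cases "w \<in> {\<tau><..\<tau> + b}")
        case True
        then have "\<beta> * w \<le> \<beta> * (\<tau> + b)"
          using assms(1,2) by (intro mult_left_mono) auto
        then have "- \<beta> * \<tau> - 1 \<le> - \<beta> * w"
          using b by (simp add: algebra_simps)
        then have "1 / sqrt (\<tau> + b) * exp (- \<beta> * \<tau> - 1) \<le> 1 / sqrt w * exp (- \<beta> * w)"
          using True assms(1,2) by (intro mult_mono) (auto simp: frac_le)
        then show ?thesis
          using True assms(1,2) by (simp add: p_eq ennreal_leI)
      qed simp
    qed
    finally show ?thesis .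
  qed
  show ?thesis
  proof (cases "\<tau> \<ge> 3 * b")
    case True
    \<comment> \<open>A pure exponential would favour distance 5 b; 2 b keeps u away from the
      singularity at 0. The threshold 3 b is exactly what gives \<tau> + b \<le> 4 u, so that the
      square roots differ by a factor of at most 2.\<close>
    define u where "u = \<tau> - 2 * b"
    have u: "u > 0" "\<tau> + b \<le> 4 * u"
      using True b by (auto simp: u_def)
    have "(\<integral>\<^sup>+w. ennreal (max 0 (w - u) ^ 5) * p w \<partial>lborel)
        \<le> (\<integral>\<^sup>+w. ennreal ((w - u) ^ 5 * (1 / sqrt u * exp (- \<beta> * u) * exp (- \<beta> * (w - u)))) * indicator {u..} w \<partial>lborel)"
    proof (rule nn_integral_mono)
      fix w
      show "ennreal (max 0 (w - u) ^ 5) * p w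
          \<le> ennreal ((w - u) ^ 5 * (1 / sqrt u * exp (- \<beta> * u) * exp (- \<beta> * (w - u)))) * indicator {u..} w"
      proof (cases "w \<ge> u")
        case True
        have "1 / sqrt w * exp (- \<beta> * w) \<le> 1 / sqrt u * exp (- \<beta> * w)"
          using u True by (intro mult_right_mono) (auto simp: frac_le)
        also have "\<dots> = 1 / sqrt u * exp (- \<beta> * u) * exp (- \<beta> * (w - u))"
          by (simp add: exp_add[symmetric] algebra_simps)
        finally have "(w - u) ^ 5 * (1 / sqrt w * exp (- \<beta> * w))
            \<le> (w - u) ^ 5 * (1 / sqrt u * exp (- \<beta> * u) * exp (- \<beta> * (w - u)))"
          using True by (intro mult_left_mono) auto
        then show ?thesis
          using True u by (simp add: p_eq ennreal_mult'[symmetric] ennreal_leI del: times_divide_eq_right times_divide_eq_left)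
      qed (simp add: max_def)
    qed
    also have "\<dots> = ennreal (fact 5 * (1 / sqrt u * exp (- \<beta> * u)) / \<beta> ^ Suc 5)"
      using assms(1,2) u by (intro nn_integral_shifted_gamma) auto
    also have "\<dots> \<le> ennreal (397 * (\<tau> - u) ^ 5 * (b * (1 / sqrt (\<tau> + b) * exp (- \<beta> * \<tau> - 1))))"
    proof (rule ennreal_leI)
      have "exp (3::real) \<le> 27"
        using exp_power_nat[of 3] power_mono[OF exp_le, of 3] by simp
      have "sqrt (\<tau> + b) \<le> sqrt (4 * u)"
        using u by simp
      then have "sqrt (\<tau> + b) \<le> 2 * sqrt u"
        by (simp add: real_sqrt_mult)
      then have "1 / sqrt u \<le> 2 / sqrt (\<tau> + b)"
        using u b assms(1,2) by (simp add: field_simps)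
      then have "1 / sqrt u * exp (- \<beta> * u) \<le> 2 / sqrt (\<tau> + b) * exp (- \<beta> * u)"
        by (rule mult_right_mono) simp
      also have "\<dots> = 2 / sqrt (\<tau> + b) * (exp 3 * exp (- \<beta> * \<tau> - 1))"
        using b by (simp add: u_def exp_add[symmetric] algebra_simps)
      also have "\<dots> \<le> 2 / sqrt (\<tau> + b) * (27 * exp (- \<beta> * \<tau> - 1))"
        using \<open>exp 3 \<le> 27\<close> assms(1,2) b by (intro mult_left_mono mult_right_mono) auto
      finally have "1 / sqrt u * exp (- \<beta> * u) \<le> 54 * (1 / sqrt (\<tau> + b) * exp (- \<beta> * \<tau> - 1))"
        using assms(1,2) b by (simp add: mult_left_mono divide_right_mono)
      then have "120 * b ^ 6 * (1 / sqrt u * exp (- \<beta> * u))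
          \<le> 120 * b ^ 6 * (54 * (1 / sqrt (\<tau> + b) * exp (- \<beta> * \<tau> - 1)))"
        using b by (intro mult_left_mono) auto
      also have "\<dots> = 6480 * b ^ 6 * (1 / sqrt (\<tau> + b) * exp (- \<beta> * \<tau> - 1))"
        by simp
      \<comment> \<open>12704 is 397 * 2^5, the power coming from \<tau> - u = 2 b; 6480 is 120 * 2
        * 27.\<close>
      also have "\<dots> \<le> 12704 * b ^ 6 * (1 / sqrt (\<tau> + b) * exp (- \<beta> * \<tau> - 1))"
        using b assms(1,2) by (intro mult_right_mono) auto
      finally show "fact 5 * (1 / sqrt u * exp (- \<beta> * u)) / \<beta> ^ Suc 5
          \<le> 397 * (\<tau> - u) ^ 5 * (b * (1 / sqrt (\<tau> + b) * exp (- \<beta> * \<tau> - 1)))"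
        by (simp add: b_def u_def fact_numeral power_divide eval_nat_numeral algebra_simps)
    qed
    also have "\<dots> = ennreal (397 * (\<tau> - u) ^ 5) * ennreal (b * (1 / sqrt (\<tau> + b) * exp (- \<beta> * \<tau> - 1)))"
      using b by (intro ennreal_mult') (simp add: u_def)
    also have "\<dots> \<le> ennreal (397 * (\<tau> - u) ^ 5) * Q"
      by (intro mult_left_mono Q_ge) simp
    finally show ?thesis
      using b by (intro disjI2 exI[of _ u]) (auto simp: u_def Q_def)
  next
    \<comment> \<open>The total mass is bounded by dropping the exponential on \<open>{0..b}\<close>
      and freezing the square root at b beyond it, which gives 2 \<open>sqrt b\<close> and
      \<open>sqrt b\<close>.\<close>
    case False
    have "(\<integral>\<^sup>+w. p w \<partial>lborel) \<le> (\<integral>\<^sup>+w. ennreal (w powr (- 1 / 2)) * indicator {0..b} w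
        + ennreal ((w - b) ^ 0 * (1 / sqrt b * exp (- \<beta> * (w - b)))) * indicator {b..} w \<partial>lborel)"
    proof (rule nn_integral_mono)
      fix w
      show "p w \<le> ennreal (w powr (- 1 / 2)) * indicator {0..b} w
          + ennreal ((w - b) ^ 0 * (1 / sqrt b * exp (- \<beta> * (w - b)))) * indicator {b..} w"
      proof (cases "w \<le> b")
        case True
        have "p w \<le> ennreal (w powr (- 1 / 2)) * indicator {0..b} w"
          using True assms(1,2) powr_half[of w]
          by (auto simp: p_eq field_simps intro!: ennreal_leI divide_right_mono split: split_indicator)
        then show ?thesis
          by (rule order_trans) simp
      next
        case False
        have "1 / sqrt w * exp (- \<beta> * w) \<le> 1 / sqrt b * exp (- \<beta> * (w - b))"
          using False b assms(1,2) by (intro mult_mono) (auto simp: frac_le algebra_simps)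
        then show ?thesis
          using False b by (simp add: p_eq ennreal_leI)
      qed
    qed
    also have "\<dots> = ennreal (2 * sqrt b) + ennreal (fact 0 * (1 / sqrt b) / \<beta> ^ Suc 0)"
      using nn_integral_inverse_sqrt[of b] nn_integral_shifted_gamma[of \<beta> "1 / sqrt b" b 0] b assms(1)
      by (subst nn_integral_add) simp_all
    also have "fact 0 * (1 / sqrt b) / \<beta> ^ Suc 0 = sqrt b"
      using real_div_sqrt[of b] b by (simp add: b_def mult.commute)
    also have "ennreal (2 * sqrt b) + ennreal (sqrt b) = ennreal (3 * sqrt b)"
      using b by (simp add: ennreal_plus[symmetric] del: ennreal_plus)
    also have "\<dots> \<le> ennreal (397 * (b * (1 / sqrt (\<tau> + b) * exp (- \<beta> * \<tau> - 1))))"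
    proof (rule ennreal_leI)
      \<comment> \<open>The tightest estimate: 3 * 2 * 55 = 330 stays below 397, whereas e \<le> 3
        would require 3 * 2 * 81 = 486.\<close>
      have "exp (4::real) = exp 1 ^ 4"
        using exp_power_nat[of 4] by simp
      also have "\<dots> \<le> (272 / 100) ^ 4"
        using e_less_272 by (intro power_mono) auto
      also have "\<dots> \<le> (55::real)"
        by (simp add: power_divide)
      finally have "exp (4::real) \<le> 55" .
      have "\<beta> * \<tau> \<le> \<beta> * (3 * b)"
        using False assms(1,2) by (intro mult_left_mono) auto
      then have "exp (- 4) \<le> exp (- \<beta> * \<tau> - 1)"
        using b by (simp add: algebra_simps)
      moreover have "1 / 55 \<le> exp (- 4 :: real)"
        using \<open>exp 4 \<le> 55\<close> by (simp add: exp_minus field_simps)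
      ultimately have e4: "1 / 55 \<le> exp (- \<beta> * \<tau> - 1)"
        by linarith
      have "sqrt (\<tau> + b) \<le> sqrt (4 * b)"
        using False by simp
      then have "sqrt (\<tau> + b) \<le> 2 * sqrt b"
        by (simp add: real_sqrt_mult)
      then have "1 / (2 * sqrt b) \<le> 1 / sqrt (\<tau> + b)"
        using b assms(1,2) by (intro frac_le) auto
      then have "1 / (2 * sqrt b) * (1 / 55) \<le> 1 / sqrt (\<tau> + b) * exp (- \<beta> * \<tau> - 1)"
        using e4 assms(1,2) b by (intro mult_mono) auto
      then have "397 * (b * (1 / (2 * sqrt b) * (1 / 55))) \<le> 397 * (b * (1 / sqrt (\<tau> + b) * exp (- \<beta> * \<tau> - 1)))"
        using b by (intro mult_left_mono) auto
      moreover have "397 * (b * (1 / (2 * sqrt b) * (1 / 55))) = 397 / 110 * sqrt b"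
        using b real_div_sqrt[of b] by (simp add: field_simps)
      moreover have "sqrt b > 0"
        using b by simp
      ultimately show "3 * sqrt b \<le> 397 * (b * (1 / sqrt (\<tau> + b) * exp (- \<beta> * \<tau> - 1)))"
        by linarith
    qed
    also have "\<dots> = 397 * ennreal (b * (1 / sqrt (\<tau> + b) * exp (- \<beta> * \<tau> - 1)))"
      by (subst ennreal_mult') auto
    also have "\<dots> \<le> 397 * Q"
      by (intro mult_left_mono Q_ge) simp
    finally show ?thesis
      by (simp add: Q_def)
  qed
qed

subsection \<open>Isotropic Gaussian measures\<close>

text \<open>The product over \<open>Basis\<close> lets integrals factor coordinatewise. For s = 0
  the density is 0 and the result is the zero measure, not the point mass at the origin; degenerate
  sums are therefore treated separately.\<close>

definition isotropic_gaussian :: "real \<Rightarrow> 'a::euclidean_space measure" where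
  "isotropic_gaussian s = density lborel (\<lambda>x. \<Prod>b\<in>Basis. ennreal (normal_density 0 s (x \<bullet> b)))"

lemma sets_isotropic_gaussian [simp, measurable_cong]: "sets (isotropic_gaussian s) = sets borel"
  by (simp add: isotropic_gaussian_def)

lemma space_isotropic_gaussian [simp]: "space (isotropic_gaussian s) = UNIV"
  by (simp add: isotropic_gaussian_def)

lemma emeasure_distr_nn_integral:
  assumes [measurable]: "f \<in> measurable M N" "A \<in> sets N"
  shows "emeasure (distr M N f) A = (\<integral>\<^sup>+x. indicator A (f x) \<partial>M)"
proof -
  have "emeasure (distr M N f) A = (\<integral>\<^sup>+x. indicator A x \<partial>distr M N f)"
    by simp
  also have "\<dots> = (\<integral>\<^sup>+x. indicator A (f x) \<partial>M)"
    by (rule nn_integral_distr) auto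
  finally show ?thesis .
qed

lemma prod_normal_density_inner:
  fixes x :: "'a::euclidean_space"
  shows "(\<Prod>b\<in>Basis. ennreal (normal_density 0 s (x \<bullet> b)))
    = ennreal ((1 / sqrt (2 * pi * s\<^sup>2)) ^ DIM('a) * exp (- (norm x)\<^sup>2 / (2 * s\<^sup>2)))"
proof -
  have "(\<Prod>b\<in>Basis. normal_density 0 s (x \<bullet> b))
      = (1 / sqrt (2 * pi * s\<^sup>2)) ^ DIM('a) * exp (\<Sum>b\<in>Basis. - (x \<bullet> b)\<^sup>2 / (2 * s\<^sup>2))"
    by (simp add: normal_density_def prod.distrib exp_sum prod_dividef power_divide)
  also have "(\<Sum>b\<in>Basis. - (x \<bullet> b)\<^sup>2 / (2 * s\<^sup>2)) = - (norm x)\<^sup>2 / (2 * s\<^sup>2)"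
  proof -
    have "(norm x)\<^sup>2 = (\<Sum>b\<in>Basis. (x \<bullet> b)\<^sup>2)"
      unfolding power2_norm_eq_inner by (subst euclidean_inner) (simp add: power2_eq_square)
    then show ?thesis
      by (simp add: sum_divide_distrib[symmetric] sum_negf)
  qed
  finally show ?thesis
    by (simp add: prod_ennreal)
qed

lemma nn_integral_isotropic_gaussian:
  fixes f :: "'a::euclidean_space \<Rightarrow> ennreal"
  assumes [measurable]: "f \<in> borel_measurable borel"
  shows "(\<integral>\<^sup>+x. f x \<partial>isotropic_gaussian s)
    = (\<integral>\<^sup>+x. ennreal ((1 / sqrt (2 * pi * s\<^sup>2)) ^ DIM('a) * exp (- (norm x)\<^sup>2 / (2 * s\<^sup>2))) * f x \<partial>lborel)"
  unfolding isotropic_gaussian_def prod_normal_density_inner by (rule nn_integral_density) auto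

text \<open>The density depends on the norm alone, and Lebesgue measure is invariant under
  orthogonal maps.\<close>

lemma distr_orthogonal_isotropic_gaussian:
  fixes U :: "'a::euclidean_space \<Rightarrow> 'a"
  assumes U: "orthogonal_transformation U"
  shows "distr (isotropic_gaussian s) borel U = isotropic_gaussian s"
proof (rule measure_eqI)
  fix A assume "A \<in> sets (distr (isotropic_gaussian s) borel U)"
  then have [measurable]: "A \<in> sets borel" by simp
  have "linear U" and norm_U: "\<And>x. norm (U x) = norm x"
    using U by (auto simp: orthogonal_transformation_linear orthogonal_transformation_norm)
  then have [measurable]: "U \<in> borel_measurable borel"
    by (intro borel_measurable_continuous_onI linear_continuous_on)
      (simp add: linear_conv_bounded_linear)
  have "emeasure (distr (isotropic_gaussian s) borel U) A = (\<integral>\<^sup>+x. indicator A (U x) \<partial>isotropic_gaussian s)"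
    by (rule emeasure_distr_nn_integral) auto
  also have "\<dots> = (\<integral>\<^sup>+x. ennreal ((1 / sqrt (2 * pi * s\<^sup>2)) ^ DIM('a) * exp (- (norm (U x))\<^sup>2 / (2 * s\<^sup>2)))
      * indicator A (U x) \<partial>lborel)"
    by (simp add: nn_integral_isotropic_gaussian norm_U)
  also have "\<dots> = (\<integral>\<^sup>+x. ennreal ((1 / sqrt (2 * pi * s\<^sup>2)) ^ DIM('a) * exp (- (norm x)\<^sup>2 / (2 * s\<^sup>2)))
      * indicator A x \<partial>lborel)"
    by (rule nn_integral_lborel_orthogonal[OF U]) measurable
  also have "\<dots> = (\<integral>\<^sup>+x. indicator A x \<partial>isotropic_gaussian s)"
    by (subst nn_integral_isotropic_gaussian) auto
  also have "\<dots> = emeasure (isotropic_gaussian s) A"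
    by simp
  finally show "emeasure (distr (isotropic_gaussian s) borel U) A = emeasure (isotropic_gaussian s) A" .
qed simp

lemma prod_Basis_vec: "(\<Prod>b\<in>(Basis :: (real^'d) set). f b) = (\<Prod>j\<in>UNIV. f (axis j 1))"
proof -
  have Basis_eq: "(Basis :: (real^'d) set) = range (\<lambda>j. axis j 1)"
    by (auto simp: Basis_vec_def)
  show ?thesis
    unfolding Basis_eq by (subst prod.reindex) (auto simp: inj_on_def axis_eq_axis)
qed

text \<open>Open boxes form an intersection-stable generator, and on a box both measures factor into
  the same one-dimensional normal probabilities.\<close>

lemma (in prob_space) distr_indep_normal_coordinates:
  fixes V :: "'a \<Rightarrow> real^'d"
  assumes [measurable]: "V \<in> borel_measurable M"
    and indep: "indep_vars (\<lambda>_. borel) (\<lambda>j \<omega>. V \<omega> $ j) (UNIV :: 'd set)"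
    and dist: "\<And>j. distributed M lborel (\<lambda>\<omega>. V \<omega> $ j) (normal_density 0 s)"
  shows "distr M borel V = isotropic_gaussian s"
proof (rule measure_eqI_generator_eq)
  let ?E = "range (\<lambda>(a, b). box a b :: (real^'d) set)"
  show "Int_stable ?E"
    by (auto simp: Int_stable_def box_Int_box)
  show "?E \<subseteq> Pow UNIV" "sets (distr M borel V) = sigma_sets UNIV ?E"
    "sets (isotropic_gaussian s :: (real^'d) measure) = sigma_sets UNIV ?E"
    by (simp_all add: borel_eq_box)
  let ?A = "\<lambda>n::nat. box (- (real n *\<^sub>R One)) (real n *\<^sub>R One) :: (real^'d) set"
  show "range ?A \<subseteq> ?E" "(\<Union>i. ?A i) = UNIV"
    unfolding UN_box_eq_UNIV by auto
  interpret D: prob_space "distr M borel V"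
    by (rule prob_space_distr) simp
  show "emeasure (distr M borel V) (?A i) \<noteq> \<infinity>" for i
    by simp
  fix B assume "B \<in> ?E"
  then obtain l u where B: "B = box l u" by auto
  define I where "I = (\<lambda>j x. indicator {l $ j <..< u $ j} x :: ennreal)"
  have box: "indicator (box l u) x = (\<Prod>j\<in>UNIV. I j (x $ j))" for x :: "real^'d"
    by (auto simp: I_def mem_box_cart indicator_def prod_zero_iff)
  have [measurable]: "I j \<in> borel_measurable borel" for j
    unfolding I_def by measurable
  have "emeasure (distr M borel V) B = (\<integral>\<^sup>+\<omega>. indicator (box l u) (V \<omega>) \<partial>M)"
    unfolding B by (rule emeasure_distr_nn_integral) auto
  also have "\<dots> = (\<integral>\<^sup>+\<omega>. (\<Prod>j\<in>UNIV. I j (V \<omega> $ j)) \<partial>M)"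
    by (simp add: box)
  also have "\<dots> = (\<Prod>j\<in>UNIV. \<integral>\<^sup>+\<omega>. I j (V \<omega> $ j) \<partial>M)"
    by (rule indep_vars_nn_integral) (auto intro: indep_vars_compose2[OF indep])
  also have "\<dots> = (\<Prod>j\<in>UNIV. \<integral>\<^sup>+x. ennreal (normal_density 0 s x) * I j x \<partial>lborel)"
    by (intro prod.cong refl distributed_nn_integral[OF dist, symmetric]) simp
  also have "\<dots> = (\<Prod>b\<in>(Basis :: (real^'d) set).
      \<integral>\<^sup>+x. ennreal (normal_density 0 s x) * indicator {l \<bullet> b <..< u \<bullet> b} x \<partial>lborel)"
    by (simp add: prod_Basis_vec I_def inner_axis)
  also have "\<dots> = (\<integral>\<^sup>+x. (\<Prod>b\<in>(Basis :: (real^'d) set).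
      ennreal (normal_density 0 s (x \<bullet> b)) * indicator {l \<bullet> b <..< u \<bullet> b} (x \<bullet> b)) \<partial>lborel)"
    by (rule nn_integral_lborel_prod[symmetric]) auto
  also have "\<dots> = (\<integral>\<^sup>+x. (\<Prod>b\<in>(Basis :: (real^'d) set). ennreal (normal_density 0 s (x \<bullet> b)))
      * indicator (box l u) x \<partial>lborel)"
    by (simp add: prod.distrib prod_Basis_vec box I_def inner_axis)
  also have "\<dots> = emeasure (isotropic_gaussian s) B"
    unfolding isotropic_gaussian_def B by (rule emeasure_density[symmetric]) auto
  finally show "emeasure (distr M borel V) B = emeasure (isotropic_gaussian s) B" .
qed

text \<open>The joint law is a product. The second variable is read at a second point of the same
  space, so that one summand can later be exchanged while the other is frozen.\<close>

lemma (in prob_space) nn_integral_indep_var: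
  fixes S :: "'a \<Rightarrow> 'b::second_countable_topology" and T :: "'a \<Rightarrow> 'b"
  assumes indep: "indep_var borel S borel T"
    and f [measurable]: "(\<lambda>(x, y). f x y) \<in> borel_measurable (borel \<Otimes>\<^sub>M borel)"
  shows "(\<integral>\<^sup>+\<omega>. f (S \<omega>) (T \<omega>) \<partial>M) = (\<integral>\<^sup>+\<omega>. \<integral>\<^sup>+\<omega>'. f (S \<omega>) (T \<omega>') \<partial>M \<partial>M)"
proof -
  have [measurable]: "S \<in> borel_measurable M" "T \<in> borel_measurable M"
    using indep_var_rv1[OF indep] indep_var_rv2[OF indep] by auto
  interpret T: prob_space "distr M borel T"
    by (rule prob_space_distr) simp
  have "(\<integral>\<^sup>+\<omega>. f (S \<omega>) (T \<omega>) \<partial>M)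
      = (\<integral>\<^sup>+p. (\<lambda>(x, y). f x y) p \<partial>distr M (borel \<Otimes>\<^sub>M borel) (\<lambda>\<omega>. (S \<omega>, T \<omega>)))"
    by (subst nn_integral_distr) auto
  also have "distr M (borel \<Otimes>\<^sub>M borel) (\<lambda>\<omega>. (S \<omega>, T \<omega>)) = distr M borel S \<Otimes>\<^sub>M distr M borel T"
    using indep by (simp add: indep_var_distribution_eq)
  also have "(\<integral>\<^sup>+p. (\<lambda>(x, y). f x y) p \<partial>(distr M borel S \<Otimes>\<^sub>M distr M borel T))
      = (\<integral>\<^sup>+x. \<integral>\<^sup>+y. f x y \<partial>distr M borel T \<partial>distr M borel S)"
    by (subst T.nn_integral_fst[symmetric]) auto
  also have "\<dots> = (\<integral>\<^sup>+x. \<integral>\<^sup>+\<omega>'. f x (T \<omega>') \<partial>M \<partial>distr M borel S)"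
    by (intro nn_integral_cong nn_integral_distr) auto
  also have "\<dots> = (\<integral>\<^sup>+\<omega>. \<integral>\<^sup>+\<omega>'. f (S \<omega>) (T \<omega>') \<partial>M \<partial>M)"
    by (subst nn_integral_distr) auto
  finally show ?thesis .
qed

text \<open>By Fubini the density of the sum is a convolution that factors over the coordinates,
  where variances add. It is stated for iterated integrals because independent sums appear in that
  form.\<close>

lemma isotropic_gaussian_convolution:
  fixes f :: "'a::euclidean_space \<Rightarrow> ennreal"
  assumes [measurable]: "f \<in> borel_measurable borel" and "s > 0" "t > 0"
  shows "(\<integral>\<^sup>+x. \<integral>\<^sup>+y. f (x + y) \<partial>isotropic_gaussian t \<partial>isotropic_gaussian s)
    = (\<integral>\<^sup>+z. f z \<partial>isotropic_gaussian (sqrt (s\<^sup>2 + t\<^sup>2)))"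
proof -
  define g where "g = (\<lambda>s x. \<Prod>b\<in>(Basis::'a set). ennreal (normal_density 0 s (x \<bullet> b)))"
  have [measurable]: "g s \<in> borel_measurable borel" for s
    unfolding g_def by measurable
  have int: "(\<integral>\<^sup>+x. h x \<partial>isotropic_gaussian s) = (\<integral>\<^sup>+x. g s x * h x \<partial>lborel)"
    if [measurable]: "h \<in> borel_measurable borel" for s and h :: "'a \<Rightarrow> ennreal"
    unfolding isotropic_gaussian_def g_def by (rule nn_integral_density) auto
  have conv: "(\<integral>\<^sup>+y. g s (z - y) * g t y \<partial>lborel) = g (sqrt (s\<^sup>2 + t\<^sup>2)) z" for z
  proof -
    have "(\<integral>\<^sup>+y. g s (z - y) * g t y \<partial>lborel)
        = (\<integral>\<^sup>+y. (\<Prod>b\<in>Basis. ennreal (normal_density 0 s (z \<bullet> b - y \<bullet> b) * normal_density 0 t (y \<bullet> b))) \<partial>lborel)"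
      by (simp add: g_def prod.distrib inner_diff_left ennreal_mult')
    also have "\<dots> = (\<Prod>b\<in>Basis. \<integral>\<^sup>+y. ennreal (normal_density 0 s (z \<bullet> b - y) * normal_density 0 t y) \<partial>lborel)"
      by (rule nn_integral_lborel_prod) auto
    also have "\<dots> = g (sqrt (s\<^sup>2 + t\<^sup>2)) z"
      unfolding g_def using fun_cong[OF conv_normal_density_zero_mean[OF \<open>s > 0\<close> \<open>t > 0\<close>]] by simp
    finally show ?thesis .
  qed
  have "(\<integral>\<^sup>+x. \<integral>\<^sup>+y. f (x + y) \<partial>isotropic_gaussian t \<partial>isotropic_gaussian s)
      = (\<integral>\<^sup>+x. \<integral>\<^sup>+y. g s x * (g t y * f (x + y)) \<partial>lborel \<partial>lborel)"
    by (simp add: int nn_integral_cmult)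
  also have "\<dots> = (\<integral>\<^sup>+y. \<integral>\<^sup>+x. g s x * (g t y * f (x + y)) \<partial>lborel \<partial>lborel)"
    by (rule lborel_pair.Fubini') simp
  also have "\<dots> = (\<integral>\<^sup>+y. \<integral>\<^sup>+z. g s (z - y) * g t y * f z \<partial>lborel \<partial>lborel)"
  proof (rule nn_integral_cong)
    fix y :: 'a
    show "(\<integral>\<^sup>+x. g s x * (g t y * f (x + y)) \<partial>lborel) = (\<integral>\<^sup>+z. g s (z - y) * g t y * f z \<partial>lborel)"
      using nn_integral_lborel_translation[of "\<lambda>z. g s (z - y) * g t y * f z" y]
      by (simp add: mult.assoc add.commute)
  qed
  also have "\<dots> = (\<integral>\<^sup>+z. \<integral>\<^sup>+y. g s (z - y) * g t y * f z \<partial>lborel \<partial>lborel)"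
    by (rule lborel_pair.Fubini') simp
  also have "\<dots> = (\<integral>\<^sup>+z. g (sqrt (s\<^sup>2 + t\<^sup>2)) z * f z \<partial>lborel)"
    by (simp add: nn_integral_multc conv)
  also have "\<dots> = (\<integral>\<^sup>+z. f z \<partial>isotropic_gaussian (sqrt (s\<^sup>2 + t\<^sup>2)))"
    by (simp add: int)
  finally show ?thesis .
qed

lemma (in prob_space) indep_vars_sum_scaleR:
  fixes X :: "nat \<Rightarrow> 'a \<Rightarrow> 'b::euclidean_space"
  assumes "indep_vars (\<lambda>_. borel) X UNIV"
  shows "indep_var borel (X m) borel (\<lambda>\<omega>. \<Sum>i<m. a i *\<^sub>R X i \<omega>)"
proof -
  have "indep_var
    borel ((\<lambda>f. f m) \<circ> (\<lambda>\<omega>. restrict (\<lambda>i. X i \<omega>) {m}))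
    borel ((\<lambda>f. \<Sum>i<m. a i *\<^sub>R f i) \<circ> (\<lambda>\<omega>. restrict (\<lambda>i. X i \<omega>) {..<m}))"
    by (intro indep_var_compose[OF indep_var_restrict[OF assms]]) auto
  also have "((\<lambda>f. f m) \<circ> (\<lambda>\<omega>. restrict (\<lambda>i. X i \<omega>) {m})) = X m"
    by auto
  also have "((\<lambda>f. \<Sum>i<m. a i *\<^sub>R f i) \<circ> (\<lambda>\<omega>. restrict (\<lambda>i. X i \<omega>) {..<m})) = (\<lambda>\<omega>. \<Sum>i<m. a i *\<^sub>R X i \<omega>)"
    by auto
  finally show ?thesis .
qed

subsection \<open>Moment comparison\<close>

text \<open>Passes from the matrices of the definition to orthogonal maps, for which existence of a
  map between two given vectors of equal norm is available.\<close>

lemma nn_integral_rot_invariant: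
  fixes X :: "'a \<Rightarrow> real^'d"
  assumes X: "rot_invariant M X" and [measurable]: "X \<in> borel_measurable M" "f \<in> borel_measurable borel"
    and U: "orthogonal_transformation U"
  shows "(\<integral>\<^sup>+\<omega>. f (U (X \<omega>)) \<partial>M) = (\<integral>\<^sup>+\<omega>. f (X \<omega>) \<partial>M)"
proof -
  have "linear U" and "orthogonal_matrix (matrix U)"
    using U by (auto simp: orthogonal_transformation_matrix)
  then have mat: "U = (\<lambda>x. matrix U *v x)"
    by (simp add: matrix_works linear_matrix_vector_mul_eq)
  have [measurable]: "U \<in> borel_measurable borel"
    using \<open>linear U\<close> by (intro borel_measurable_continuous_onI linear_continuous_on)
      (simp add: linear_conv_bounded_linear)
  have eq: "distr M borel (\<lambda>\<omega>. U (X \<omega>)) = distr M borel X"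
    using X \<open>orthogonal_matrix (matrix U)\<close> unfolding rot_invariant_def by (subst mat) blast
  have "(\<integral>\<^sup>+\<omega>. f (U (X \<omega>)) \<partial>M) = (\<integral>\<^sup>+x. f x \<partial>distr M borel (\<lambda>\<omega>. U (X \<omega>)))"
    by (rule nn_integral_distr[symmetric]) auto
  also have "\<dots> = (\<integral>\<^sup>+\<omega>. f (X \<omega>) \<partial>M)"
    unfolding eq by (rule nn_integral_distr) auto
  finally show ?thesis .
qed

text \<open>A rotation-invariant vector is its norm times an independent uniform direction; the direction
  is realised by normalising another rotation-invariant vector.\<close>

lemma (in prob_space) nn_integral_rot_invariant_polar:
  fixes X Y :: "'a \<Rightarrow> real^'d" and v :: "real^'d"
  assumes X: "rot_invariant M X" and [measurable]: "X \<in> borel_measurable M"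
    and Y: "rot_invariant M Y" and [measurable]: "Y \<in> borel_measurable M"
    and Y0: "AE \<omega> in M. Y \<omega> \<noteq> 0"
    and F [measurable]: "(\<lambda>(r, s). F r s) \<in> borel_measurable (borel \<Otimes>\<^sub>M (borel :: real measure))"
  shows "(\<integral>\<^sup>+\<omega>. F (norm (X \<omega>)) (v \<bullet> X \<omega>) \<partial>M)
    = (\<integral>\<^sup>+\<omega>. \<integral>\<^sup>+\<omega>'. F (norm (X \<omega>)) (norm (X \<omega>) * (v \<bullet> sgn (Y \<omega>'))) \<partial>M \<partial>M)"
proof -
  interpret MM: pair_sigma_finite M M ..
  have [measurable]: "(\<lambda>x::real^'d. sgn x) \<in> borel_measurable borel"
    unfolding sgn_div_norm by measurable
  \<comment> \<open>Invariance of X lets the direction of v be replaced by any unit vector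
    e.\<close>
  have rotX: "(\<integral>\<^sup>+\<omega>. F (norm (X \<omega>)) (v \<bullet> X \<omega>) \<partial>M) = (\<integral>\<^sup>+\<omega>. F (norm (X \<omega>)) (norm v * (e \<bullet> X \<omega>)) \<partial>M)"
    if "norm e = 1" for e
  proof -
    have "norm v = norm (norm v *\<^sub>R e)"
      using that by simp
    then obtain U where U: "orthogonal_transformation U" "U v = norm v *\<^sub>R e"
      using orthogonal_transformation_exists by blast
    have "norm (X \<omega>) = norm (U (X \<omega>))" "v \<bullet> X \<omega> = norm v * (e \<bullet> U (X \<omega>))" for \<omega>
      using U orthogonal_transformation_norm[OF U(1)]
      by (auto simp: orthogonal_transformation_def simp flip: U(2) inner_scaleR_left)
    then have "(\<integral>\<^sup>+\<omega>. F (norm (X \<omega>)) (v \<bullet> X \<omega>) \<partial>M)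
        = (\<integral>\<^sup>+\<omega>. F (norm (U (X \<omega>))) (norm v * (e \<bullet> U (X \<omega>))) \<partial>M)"
      by simp
    also have "\<dots> = (\<integral>\<^sup>+\<omega>. F (norm (X \<omega>)) (norm v * (e \<bullet> X \<omega>)) \<partial>M)"
      by (rule nn_integral_rot_invariant[OF X _ _ U(1)]) auto
    finally show ?thesis .
  qed
  \<comment> \<open>For fixed x, invariance of Y exchanges the directions of x and v. Each vector is
    scaled by the norm of the other, so the zero vector needs no separate case.\<close>
  have rotY: "(\<integral>\<^sup>+\<omega>. F (norm x) (norm v * (sgn (Y \<omega>) \<bullet> x)) \<partial>M) = (\<integral>\<^sup>+\<omega>. F (norm x) (norm x * (v \<bullet> sgn (Y \<omega>))) \<partial>M)" for x
  proof -
    have "norm (norm v *\<^sub>R x) = norm (norm x *\<^sub>R v)"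
      by simp
    then obtain U where U: "orthogonal_transformation U" "U (norm v *\<^sub>R x) = norm x *\<^sub>R v"
      using orthogonal_transformation_exists by blast
    have "norm v * (sgn y \<bullet> x) = norm x * (v \<bullet> sgn (U y))" for y
    proof -
      have "norm v * (sgn y \<bullet> x) = sgn y \<bullet> (norm v *\<^sub>R x)"
        by simp
      also have "\<dots> = U (sgn y) \<bullet> U (norm v *\<^sub>R x)"
        using U(1) by (simp only: orthogonal_transformation_def)
      also have "U (sgn y) = sgn (U y)"
        using U(1) by (simp add: sgn_div_norm orthogonal_transformation_norm linear_scale orthogonal_transformation_linear)
      finally show ?thesis
        by (simp add: U(2) inner_commute)
    qed
    then have "(\<integral>\<^sup>+\<omega>. F (norm x) (norm v * (sgn (Y \<omega>) \<bullet> x)) \<partial>M) = (\<integral>\<^sup>+\<omega>. F (norm x) (norm x * (v \<bullet> sgn (U (Y \<omega>)))) \<partial>M)"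
      by simp
    also have "\<dots> = (\<integral>\<^sup>+\<omega>. F (norm x) (norm x * (v \<bullet> sgn (Y \<omega>))) \<partial>M)"
      by (rule nn_integral_rot_invariant[OF Y _ _ U(1)]) auto
    finally show ?thesis .
  qed
  have "(\<integral>\<^sup>+\<omega>. F (norm (X \<omega>)) (v \<bullet> X \<omega>) \<partial>M) = (\<integral>\<^sup>+\<omega>'. (\<integral>\<^sup>+\<omega>. F (norm (X \<omega>)) (v \<bullet> X \<omega>) \<partial>M) \<partial>M)"
    by (simp add: emeasure_space_1)
  also have "\<dots> = (\<integral>\<^sup>+\<omega>'. (\<integral>\<^sup>+\<omega>. F (norm (X \<omega>)) (norm v * (sgn (Y \<omega>') \<bullet> X \<omega>)) \<partial>M) \<partial>M)"
    \<comment> \<open>Here e is \<open>sgn (Y \<omega>')\<close>, a unit vector for almost every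
      \<omega>'.\<close>
    using Y0 by (intro nn_integral_cong_AE) (auto elim!: eventually_mono intro!: rotX simp: norm_sgn)
  also have "\<dots> = (\<integral>\<^sup>+\<omega>. (\<integral>\<^sup>+\<omega>'. F (norm (X \<omega>)) (norm v * (sgn (Y \<omega>') \<bullet> X \<omega>)) \<partial>M) \<partial>M)"
    by (rule MM.Fubini') measurable
  also have "\<dots> = (\<integral>\<^sup>+\<omega>. (\<integral>\<^sup>+\<omega>'. F (norm (X \<omega>)) (norm (X \<omega>) * (v \<bullet> sgn (Y \<omega>'))) \<partial>M) \<partial>M)"
    by (simp add: rotY)
  finally show ?thesis .
qed

text \<open>Both vectors are given the same random direction, that of G at a separate sample point.
  For each fixed direction only radii are compared: the radius of X is raised to 1 by monotonicity,
  and 1 is passed to \<open>c * norm (G \<omega>)\<close>, whose square has mean 1, by the support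
  line.\<close>

lemma (in prob_space) hinge_moment_comparison_one_step:
  fixes X G :: "'a \<Rightarrow> real^'d" and v :: "real^'d"
  assumes X: "rot_invariant M X" and [measurable]: "X \<in> borel_measurable M"
    and X1: "AE \<omega> in M. norm (X \<omega>) \<le> 1"
    and G: "rot_invariant M G" and [measurable]: "G \<in> borel_measurable M"
    and G0: "AE \<omega> in M. G \<omega> \<noteq> 0" and c: "c \<ge> 0"
    and G2: "(\<integral>\<^sup>+\<omega>. ennreal ((c * norm (G \<omega>))\<^sup>2) \<partial>M) = 1"
  shows "(\<integral>\<^sup>+\<omega>. ennreal (max 0 ((norm (v + a *\<^sub>R X \<omega>))\<^sup>2 - u) ^ 5) \<partial>M)
    \<le> (\<integral>\<^sup>+\<omega>. ennreal (max 0 ((norm (v + (a * c) *\<^sub>R G \<omega>))\<^sup>2 - u) ^ 5) \<partial>M)"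
proof -
  interpret MM: pair_sigma_finite M M ..
  have [measurable]: "(\<lambda>x::real^'d. sgn x) \<in> borel_measurable borel"
    unfolding sgn_div_norm by measurable
  define A where "A = (norm v)\<^sup>2 - u"
  define \<theta> where "\<theta> = (\<lambda>\<omega>. v \<bullet> sgn (G \<omega>))"
  have [measurable]: "\<theta> \<in> borel_measurable M"
    unfolding \<theta>_def by measurable
  \<comment> \<open>\<open>h t r\<close> is the hinge at v plus a vector of length r times a unit
    direction, the whole length scaled by a, where t is the inner product of v with that
    direction.\<close>
  define h where "h = (\<lambda>t r. max 0 (A + a\<^sup>2 * r\<^sup>2 + 2 * a * t * r) ^ 5)"
  define n where "n = (\<lambda>t r. h t r + h (- t) r)"
  have h_nonneg: "h t r \<ge> 0" for t r
    by (simp add: h_def)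
  \<comment> \<open>Used with b = 1 for X and b = c for G. The moments are doubled so that pairing
    opposite directions needs no halving in \<open>ennreal\<close>.\<close>
  have polar: "(\<integral>\<^sup>+\<omega>. ennreal (max 0 ((norm (v + (a * b) *\<^sub>R Z \<omega>))\<^sup>2 - u) ^ 5) \<partial>M) * 2
      = (\<integral>\<^sup>+\<omega>. \<integral>\<^sup>+\<omega>'. ennreal (n (\<theta> \<omega>') (b * norm (Z \<omega>))) \<partial>M \<partial>M)"
    if Z: "rot_invariant M Z" and [measurable]: "Z \<in> borel_measurable M" for Z :: "'a \<Rightarrow> real^'d" and b
  proof -
    have "(norm (v + (a * b) *\<^sub>R z))\<^sup>2 - u = A + a\<^sup>2 * (b * norm z)\<^sup>2 + 2 * a * b * (v \<bullet> z)" for z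
      by (simp add: A_def power2_norm_eq_inner inner_add_left inner_add_right inner_commute power_mult_distrib
        power2_eq_square[of a] power2_eq_square[of b])
    then have "(\<integral>\<^sup>+\<omega>. ennreal (max 0 ((norm (v + (a * b) *\<^sub>R Z \<omega>))\<^sup>2 - u) ^ 5) \<partial>M)
        = (\<integral>\<^sup>+\<omega>. (\<lambda>r s. ennreal (max 0 (A + a\<^sup>2 * (b * r)\<^sup>2 + 2 * a * b * s) ^ 5)) (norm (Z \<omega>)) (v \<bullet> Z \<omega>) \<partial>M)"
      by simp
    also have "\<dots> = (\<integral>\<^sup>+\<omega>. \<integral>\<^sup>+\<omega>'. ennreal (h (\<theta> \<omega>') (b * norm (Z \<omega>))) \<partial>M \<partial>M)"
      by (subst nn_integral_rot_invariant_polar[OF Z _ G _ G0]) (auto simp: h_def \<theta>_def mult_ac)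
    finally have "(\<integral>\<^sup>+\<omega>. ennreal (max 0 ((norm (v + (a * b) *\<^sub>R Z \<omega>))\<^sup>2 - u) ^ 5) \<partial>M) * 2
        = (\<integral>\<^sup>+\<omega>. (\<integral>\<^sup>+\<omega>'. ennreal (h (\<theta> \<omega>') (b * norm (Z \<omega>))) \<partial>M) * 2 \<partial>M)"
      by (simp add: nn_integral_multc h_def)
    also have "\<dots> = (\<integral>\<^sup>+\<omega>. \<integral>\<^sup>+\<omega>'. ennreal (n (\<theta> \<omega>') (b * norm (Z \<omega>))) \<partial>M \<partial>M)"
    proof (rule nn_integral_cong)
      fix \<omega>
      let ?r = "b * norm (Z \<omega>)"
      \<comment> \<open>Negation is orthogonal, so \<theta> and its negative contribute
        equally.\<close>
      have neg: "orthogonal_transformation (\<lambda>x::real^'d. - x)"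
        by (simp add: orthogonal_transformation_def linear_uminus)
      have "(\<integral>\<^sup>+\<omega>'. ennreal (h (\<theta> \<omega>') ?r) \<partial>M) = (\<integral>\<^sup>+\<omega>'. ennreal (h (v \<bullet> sgn (- G \<omega>')) ?r) \<partial>M)"
        unfolding \<theta>_def h_def
        by (rule nn_integral_rot_invariant[OF G _ _ neg, symmetric]) measurable
      then have "(\<integral>\<^sup>+\<omega>'. ennreal (h (\<theta> \<omega>') ?r) \<partial>M) * 2
          = (\<integral>\<^sup>+\<omega>'. ennreal (h (\<theta> \<omega>') ?r) \<partial>M) + (\<integral>\<^sup>+\<omega>'. ennreal (h (- \<theta> \<omega>') ?r) \<partial>M)"
        by (simp add: \<theta>_def sgn_minus mult_2_right)
      also have "\<dots> = (\<integral>\<^sup>+\<omega>'. ennreal (n (\<theta> \<omega>') ?r) \<partial>M)"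
        unfolding n_def using h_nonneg by (simp add: h_def nn_integral_add)
      finally show "(\<integral>\<^sup>+\<omega>'. ennreal (h (\<theta> \<omega>') ?r) \<partial>M) * 2 = (\<integral>\<^sup>+\<omega>'. ennreal (n (\<theta> \<omega>') ?r) \<partial>M)" .
    qed
    finally show ?thesis .
  qed
  have n_nonneg: "n t r \<ge> 0" for t r
    using h_nonneg by (simp add: n_def)
  have support: "\<exists>k\<ge>0. (\<forall>r\<ge>0. n t 1 + k * r\<^sup>2 \<le> n t r + k) \<and> (\<forall>r. 0 \<le> r \<longrightarrow> r \<le> 1 \<longrightarrow> n t r \<le> n t 1)" for t
    by (rule even_part_support_line[of "a\<^sup>2" A "2 * a * t"]) (auto simp: n_def h_def)
  have le: "(\<integral>\<^sup>+\<omega>. \<integral>\<^sup>+\<omega>'. ennreal (n (\<theta> \<omega>') (1 * norm (X \<omega>))) \<partial>M \<partial>M) \<le> (\<integral>\<^sup>+\<omega>'. ennreal (n (\<theta> \<omega>') 1) \<partial>M)"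
  proof -
    have "(\<integral>\<^sup>+\<omega>. \<integral>\<^sup>+\<omega>'. ennreal (n (\<theta> \<omega>') (1 * norm (X \<omega>))) \<partial>M \<partial>M)
        \<le> (\<integral>\<^sup>+\<omega>. \<integral>\<^sup>+\<omega>'. ennreal (n (\<theta> \<omega>') 1) \<partial>M \<partial>M)"
      using X1 by (intro nn_integral_mono_AE) (auto elim!: eventually_mono intro!: nn_integral_mono ennreal_leI,
        use support norm_ge_zero in blast)
    then show ?thesis
      by (simp add: emeasure_space_1)
  qed
  \<comment> \<open>Jensen's inequality by integrating the support line; the finite constant k then
    occurs on both sides and cancels.\<close>
  have ge: "ennreal (n t 1) \<le> (\<integral>\<^sup>+\<omega>. ennreal (n t (c * norm (G \<omega>))) \<partial>M)" for t
  proof -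
    obtain k where k: "k \<ge> 0" "\<And>r. r \<ge> 0 \<Longrightarrow> n t 1 + k * r\<^sup>2 \<le> n t r + k"
      using support by blast
    have [measurable]: "n t \<in> borel_measurable borel"
      unfolding n_def h_def by measurable
    have "ennreal (n t 1) + ennreal k = (\<integral>\<^sup>+\<omega>. ennreal (n t 1) + ennreal k * ennreal ((c * norm (G \<omega>))\<^sup>2) \<partial>M)"
      by (subst nn_integral_add) (auto simp: nn_integral_cmult G2 emeasure_space_1)
    also have "\<dots> \<le> (\<integral>\<^sup>+\<omega>. ennreal (n t (c * norm (G \<omega>))) + ennreal k \<partial>M)"
      using k c n_nonneg by (intro nn_integral_mono)
        (auto simp: ennreal_mult'[symmetric] ennreal_plus[symmetric] simp del: ennreal_plus intro!: ennreal_leI)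
    also have "\<dots> = (\<integral>\<^sup>+\<omega>. ennreal (n t (c * norm (G \<omega>))) \<partial>M) + ennreal k"
      by (subst nn_integral_add) (auto simp: emeasure_space_1)
    finally show ?thesis
      by (simp add: ennreal_add_left_cancel_le add.commute)
  qed
  have "(\<integral>\<^sup>+\<omega>. ennreal (max 0 ((norm (v + a *\<^sub>R X \<omega>))\<^sup>2 - u) ^ 5) \<partial>M) * 2
      = (\<integral>\<^sup>+\<omega>. \<integral>\<^sup>+\<omega>'. ennreal (n (\<theta> \<omega>') (1 * norm (X \<omega>))) \<partial>M \<partial>M)"
    using polar[OF X, of 1] by simp
  also note le
  also have "(\<integral>\<^sup>+\<omega>'. ennreal (n (\<theta> \<omega>') 1) \<partial>M) \<le> (\<integral>\<^sup>+\<omega>'. \<integral>\<^sup>+\<omega>. ennreal (n (\<theta> \<omega>') (c * norm (G \<omega>))) \<partial>M \<partial>M)"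
    by (intro nn_integral_mono ge)
  also have "\<dots> = (\<integral>\<^sup>+\<omega>. \<integral>\<^sup>+\<omega>'. ennreal (n (\<theta> \<omega>') (c * norm (G \<omega>))) \<partial>M \<partial>M)"
    unfolding n_def h_def by (rule MM.Fubini') measurable
  also have "\<dots> = (\<integral>\<^sup>+\<omega>. ennreal (max 0 ((norm (v + (a * c) *\<^sub>R G \<omega>))\<^sup>2 - u) ^ 5) \<partial>M) * 2"
    using polar[OF G, of c] by simp
  finally show ?thesis
    using ennreal_mult_le_mult_iff[of 2] by (simp add: mult.commute)
qed

subsection \<open>Gaussian sums and the tail bound\<close>

text \<open>The normalising constant stays unevaluated: it is a common factor of both sides of every
  tail comparison.\<close>

lemma nn_integral_norm_squared_isotropic_gaussian:
  fixes f :: "real \<Rightarrow> ennreal"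
  assumes [measurable]: "f \<in> borel_measurable borel"
  shows "(\<integral>\<^sup>+x. f ((norm x)\<^sup>2) \<partial>(isotropic_gaussian s :: 'a::euclidean_space measure))
    = ennreal ((1 / sqrt (2 * pi * s\<^sup>2)) ^ DIM('a) * (unit_ball_vol (real DIM('a)) * (DIM('a) / 2)))
      * (\<integral>\<^sup>+w. f w * (ennreal (w powr (DIM('a) / 2 - 1) * exp (- (1 / (2 * s\<^sup>2)) * w)) * indicator {0..} w) \<partial>lborel)"
    (is "_ = ennreal (?K * ?V) * _")
proof -
  define g where "g = (\<lambda>w. ennreal (?K * exp (- w / (2 * s\<^sup>2))) * f w)"
  have [measurable]: "g \<in> borel_measurable borel"
    unfolding g_def by measurable
  have "(\<integral>\<^sup>+x. f ((norm x)\<^sup>2) \<partial>(isotropic_gaussian s :: 'a measure)) = (\<integral>\<^sup>+x. g ((norm (x :: 'a))\<^sup>2) \<partial>lborel)"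
    by (subst nn_integral_isotropic_gaussian) (auto simp: g_def)
  also have "\<dots> = (\<integral>\<^sup>+w. g w \<partial>distr lborel borel (\<lambda>x::'a. (norm x)\<^sup>2))"
    by (rule nn_integral_distr[symmetric]) auto
  also have "\<dots> = (\<integral>\<^sup>+w. ennreal (?V * w powr (DIM('a) / 2 - 1)) * indicator {0..} w * g w \<partial>lborel)"
    unfolding distr_lborel_norm_squared by (subst nn_integral_density) auto
  also have "\<dots> = (\<integral>\<^sup>+w. ennreal (?K * ?V) * (f w * (ennreal (w powr (DIM('a) / 2 - 1) * exp (- (1 / (2 * s\<^sup>2)) * w))
      * indicator {0..} w)) \<partial>lborel)"
  proof (rule nn_integral_cong)
    fix w
    have "ennreal (?V * w powr (DIM('a) / 2 - 1)) * ennreal (?K * exp (- w / (2 * s\<^sup>2)))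
        = ennreal (?K * ?V) * ennreal (w powr (DIM('a) / 2 - 1) * exp (- (1 / (2 * s\<^sup>2)) * w))"
      by (subst (1 2) ennreal_mult'[symmetric]) (auto simp: algebra_simps)
    then show "ennreal (?V * w powr (DIM('a) / 2 - 1)) * indicator {0..} w * g w
        = ennreal (?K * ?V) * (f w * (ennreal (w powr (DIM('a) / 2 - 1) * exp (- (1 / (2 * s\<^sup>2)) * w)) * indicator {0..} w))"
      unfolding g_def by (simp add: mult_ac)
  qed
  also have "\<dots> = ennreal (?K * ?V) * (\<integral>\<^sup>+w. f w * (ennreal (w powr (DIM('a) / 2 - 1) * exp (- (1 / (2 * s\<^sup>2)) * w))
      * indicator {0..} w) \<partial>lborel)"
    by (rule nn_integral_cmult) measurable
  finally show ?thesis .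
qed

text \<open>In the first alternative the tail is so heavy that the trivial bound 1 on a probability
  is enough; the second supplies the hinge for Markov's inequality.\<close>

lemma isotropic_gaussian_hinge_tail:
  fixes s \<tau> :: real
  assumes "s > 0" "\<tau> > 0"
  defines "\<Gamma> \<equiv> isotropic_gaussian s :: 'a::euclidean_space measure"
  shows "emeasure \<Gamma> UNIV \<le> 397 * emeasure \<Gamma> {x. (norm x)\<^sup>2 > \<tau>} \<or>
    (\<exists>u<\<tau>. (\<integral>\<^sup>+x. ennreal (max 0 ((norm x)\<^sup>2 - u) ^ 5) \<partial>\<Gamma>)
      \<le> ennreal (397 * (\<tau> - u) ^ 5) * emeasure \<Gamma> {x. (norm x)\<^sup>2 > \<tau>})"
proof -
  define K where "K = (1 / sqrt (2 * pi * s\<^sup>2)) ^ DIM('a) * (unit_ball_vol (real DIM('a)) * (DIM('a) / 2))"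
  define p where "p = (\<lambda>w. ennreal (w powr (DIM('a) / 2 - 1) * exp (- (1 / (2 * s\<^sup>2)) * w)) * indicator {0..} w)"
  have \<Gamma>: "(\<integral>\<^sup>+x. f ((norm x)\<^sup>2) \<partial>\<Gamma>) = ennreal K * (\<integral>\<^sup>+w. f w * p w \<partial>lborel)"
    if "f \<in> borel_measurable borel" for f
    unfolding K_def p_def \<Gamma>_def using nn_integral_norm_squared_isotropic_gaussian[OF that] .
  have tail: "emeasure \<Gamma> {x. (norm x)\<^sup>2 > \<tau>} = ennreal K * (\<integral>\<^sup>+w. p w * indicator {\<tau><..} w \<partial>lborel)"
  proof -
    have "emeasure \<Gamma> {x. (norm x)\<^sup>2 > \<tau>} = (\<integral>\<^sup>+x. indicator {x. (norm x)\<^sup>2 > \<tau>} x \<partial>\<Gamma>)"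
      by (rule nn_integral_indicator[symmetric]) (simp add: \<Gamma>_def)
    also have "\<dots> = (\<integral>\<^sup>+x. indicator {\<tau><..} ((norm x)\<^sup>2) \<partial>\<Gamma>)"
      by (simp add: indicator_def)
    finally show ?thesis
      by (subst (asm) \<Gamma>) (auto simp: mult.commute)
  qed
  have "emeasure \<Gamma> UNIV = (\<integral>\<^sup>+x. 1 \<partial>\<Gamma>)"
    by (simp add: \<Gamma>_def)
  then have total: "emeasure \<Gamma> UNIV = ennreal K * (\<integral>\<^sup>+w. p w \<partial>lborel)"
    by (subst (asm) \<Gamma>) auto
  have gamma: "(\<integral>\<^sup>+w. p w \<partial>lborel) \<le> 397 * (\<integral>\<^sup>+w. p w * indicator {\<tau><..} w \<partial>lborel) \<or>
    (\<exists>u<\<tau>. (\<integral>\<^sup>+w. ennreal (max 0 (w - u) ^ 5) * p w \<partial>lborel)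
    \<le> ennreal (397 * (\<tau> - u) ^ 5) * (\<integral>\<^sup>+w. p w * indicator {\<tau><..} w \<partial>lborel))"
  proof (cases "DIM('a) = 1")
    case True
    then have "real DIM('a) / 2 - 1 = - 1 / 2"
      by simp
    then show ?thesis
      unfolding p_def using gamma_hinge_tail_half[of "1 / (2 * s\<^sup>2)" \<tau>] assms(1,2) by (simp only:) simp
  next
    case False
    then have "DIM('a) \<ge> 2"
      using DIM_positive[where 'a = 'a] by linarith
    then have "real DIM('a) / 2 - 1 \<ge> 0"
      by simp
    then show ?thesis
      unfolding p_def using assms(1,2) by (intro disjI2 gamma_hinge_tail_log_concave) auto
  qed
  then show ?thesis
  proof
    assume "(\<integral>\<^sup>+w. p w \<partial>lborel) \<le> 397 * (\<integral>\<^sup>+w. p w * indicator {\<tau><..} w \<partial>lborel)"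
    then show ?thesis
      unfolding total tail by (intro disjI1) (simp add: mult.left_commute mult_left_mono)
  next
    assume "\<exists>u<\<tau>. (\<integral>\<^sup>+w. ennreal (max 0 (w - u) ^ 5) * p w \<partial>lborel)
      \<le> ennreal (397 * (\<tau> - u) ^ 5) * (\<integral>\<^sup>+w. p w * indicator {\<tau><..} w \<partial>lborel)"
    then obtain u where u: "u < \<tau>" "(\<integral>\<^sup>+w. ennreal (max 0 (w - u) ^ 5) * p w \<partial>lborel)
      \<le> ennreal (397 * (\<tau> - u) ^ 5) * (\<integral>\<^sup>+w. p w * indicator {\<tau><..} w \<partial>lborel)"
      by blast
    have "(\<integral>\<^sup>+x. ennreal (max 0 ((norm x)\<^sup>2 - u) ^ 5) \<partial>\<Gamma>)
        = ennreal K * (\<integral>\<^sup>+w. ennreal (max 0 (w - u) ^ 5) * p w \<partial>lborel)"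
      by (rule \<Gamma>) measurable
    also have "\<dots> \<le> ennreal K * (ennreal (397 * (\<tau> - u) ^ 5) * (\<integral>\<^sup>+w. p w * indicator {\<tau><..} w \<partial>lborel))"
      by (intro mult_left_mono u) simp
    finally show ?thesis
      using u(1) unfolding tail by (intro disjI2 exI[of _ u]) (simp add: mult.left_commute)
  qed
qed

context prob_space
begin

section \<open>Standard Gaussian vectors and their sums\<close>

lemma distr_scaled_std_gaussian_vector:
  assumes G: "std_gaussian_vector M G" and "b \<noteq> 0"
  shows "distr M borel (\<lambda>\<omega>. b *\<^sub>R G \<omega>) = isotropic_gaussian \<bar>b\<bar>"
proof (rule distr_indep_normal_coordinates)
  have indep: "indep_vars (\<lambda>_. borel) (\<lambda>j \<omega>. G \<omega> $ j) UNIV"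
    and dist: "distributed M lborel (\<lambda>\<omega>. G \<omega> $ j) (normal_density 0 1)" for j
    using G by (auto simp: std_gaussian_vector_def)
  show "(\<lambda>\<omega>. b *\<^sub>R G \<omega>) \<in> borel_measurable M"
    using G by (auto simp: std_gaussian_vector_def)
  show "indep_vars (\<lambda>_. borel) (\<lambda>j \<omega>. (b *\<^sub>R G \<omega>) $ j) UNIV"
    using indep_vars_compose2[OF indep, of "\<lambda>_ x. b * x" "\<lambda>_. borel"] by simp
  show "distributed M lborel (\<lambda>\<omega>. (b *\<^sub>R G \<omega>) $ j) (normal_density 0 \<bar>b\<bar>)" for j
    using normal_density_affine[OF dist zero_less_one \<open>b \<noteq> 0\<close>, of 0] \<open>b \<noteq> 0\<close> by simp
qed

lemma distr_std_gaussian_vector: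
  assumes "std_gaussian_vector M G"
  shows "distr M borel G = isotropic_gaussian 1"
  using distr_scaled_std_gaussian_vector[OF assms, of 1] by simp

lemma rot_invariant_std_gaussian_vector:
  fixes G :: "'a \<Rightarrow> real^'d"
  assumes G: "std_gaussian_vector M G"
  shows "rot_invariant M G"
  unfolding rot_invariant_def
proof (intro allI impI)
  fix U :: "real^'d^'d"
  assume "orthogonal_matrix U"
  then have U: "orthogonal_transformation (\<lambda>x. U *v x)"
    by (simp add: orthogonal_transformation_matrix)
  have [measurable]: "G \<in> borel_measurable M"
    using G by (simp add: std_gaussian_vector_def)
  have [measurable]: "(\<lambda>x. U *v x) \<in> borel_measurable borel"
    by (intro borel_measurable_continuous_onI continuous_intros)
  have "distr M borel (\<lambda>\<omega>. U *v G \<omega>) = distr (distr M borel G) borel (\<lambda>x. U *v x)"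
    by (subst distr_distr) (auto simp: comp_def)
  also have "\<dots> = distr M borel G"
    using distr_orthogonal_isotropic_gaussian[OF U] by (simp add: distr_std_gaussian_vector[OF G])
  finally show "distr M borel (\<lambda>\<omega>. U *v G \<omega>) = distr M borel G" .
qed

lemma std_gaussian_vector_AE_nonzero:
  fixes G :: "'a \<Rightarrow> real^'d"
  assumes G: "std_gaussian_vector M G"
  shows "AE \<omega> in M. G \<omega> \<noteq> 0"
proof -
  have [measurable]: "G \<in> borel_measurable M"
    using G by (simp add: std_gaussian_vector_def)
  have "AE x in isotropic_gaussian 1. x \<noteq> (0 :: real^'d)"
    unfolding isotropic_gaussian_def using AE_lborel_singleton[of "0 :: real^'d"]
    by (subst AE_density) (auto elim: eventually_mono)
  then have "AE x in distr M borel G. x \<noteq> 0"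
    unfolding distr_std_gaussian_vector[OF G] .
  then show ?thesis
    by (subst (asm) AE_distr_iff) auto
qed

lemma std_gaussian_vector_norm_squared:
  fixes G :: "'a \<Rightarrow> real^'d"
  assumes G: "std_gaussian_vector M G"
  shows "(\<integral>\<^sup>+\<omega>. ennreal ((norm (G \<omega>))\<^sup>2) \<partial>M) = ennreal (real CARD('d))"
proof -
  have [measurable]: "(\<lambda>\<omega>. G \<omega> $ j) \<in> borel_measurable M" for j
    using G by (auto simp: std_gaussian_vector_def distributed_def)
  have coord: "(\<integral>\<^sup>+\<omega>. ennreal ((G \<omega> $ j)\<^sup>2) \<partial>M) = 1" for j
  proof -
    have "(\<integral>\<^sup>+\<omega>. ennreal ((G \<omega> $ j)\<^sup>2) \<partial>M) = (\<integral>\<^sup>+x. ennreal (std_normal_density x) * ennreal (x\<^sup>2) \<partial>lborel)"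
      using G by (intro distributed_nn_integral[symmetric]) (auto simp: std_gaussian_vector_def)
    also have "\<dots> = (\<integral>\<^sup>+x. ennreal (std_normal_density x * x\<^sup>2) \<partial>lborel)"
      by (simp add: ennreal_mult')
    also have "\<dots> = ennreal (\<integral>x. std_normal_density x * x\<^sup>2 \<partial>lborel)"
      using std_normal_moment_even[of 1] by (intro nn_integral_eq_integral) (auto simp: has_bochner_integral_iff)
    also have "\<dots> = 1"
      using integral_std_normal_moment_even[of 1] by simp
    finally show ?thesis .
  qed
  have "(norm x)\<^sup>2 = (\<Sum>j\<in>UNIV. (x $ j)\<^sup>2)" for x :: "real^'d"
    unfolding power2_norm_eq_inner inner_vec_def by (simp add: power2_eq_square)
  then have "(\<integral>\<^sup>+\<omega>. ennreal ((norm (G \<omega>))\<^sup>2) \<partial>M) = (\<integral>\<^sup>+\<omega>. (\<Sum>j\<in>UNIV. ennreal ((G \<omega> $ j)\<^sup>2)) \<partial>M)"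
    by (simp add: sum_ennreal)
  also have "\<dots> = (\<Sum>j\<in>(UNIV::'d set). \<integral>\<^sup>+\<omega>. ennreal ((G \<omega> $ j)\<^sup>2) \<partial>M)"
    by (rule nn_integral_sum) measurable
  finally show ?thesis
    by (simp add: coord ennreal_of_nat_eq_real_of_nat)
qed

text \<open>Induction by convolution. Positivity of the variance excludes the constant sum, whose
  law is not an \<open>isotropic_gaussian\<close>.\<close>

lemma distr_sum_std_gaussian_vectors:
  fixes G :: "nat \<Rightarrow> 'a \<Rightarrow> real^'d"
  assumes indep: "indep_vars (\<lambda>_. borel) G UNIV" and G: "\<And>i. std_gaussian_vector M (G i)"
  shows "(\<Sum>i<m. (b i)\<^sup>2) > 0 \<Longrightarrow>
    distr M borel (\<lambda>\<omega>. \<Sum>i<m. b i *\<^sub>R G i \<omega>) = isotropic_gaussian (sqrt (\<Sum>i<m. (b i)\<^sup>2))"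
proof (induction m)
  case (Suc m)
  have [measurable]: "G i \<in> borel_measurable M" for i
    using G by (simp add: std_gaussian_vector_def)
  define T where "T = (\<Sum>i<m. (b i)\<^sup>2)"
  have "T \<ge> 0"
    by (simp add: T_def sum_nonneg)
  \<comment> \<open>Convolution needs two nondegenerate summands, so a vanishing new term and a
    vanishing partial sum are split off.\<close>
  consider "b m = 0" | "T = 0" "b m \<noteq> 0" | "T > 0" "b m \<noteq> 0"
    using \<open>T \<ge> 0\<close> by linarith
  then show ?case
  proof cases
    case 1
    then show ?thesis
      using Suc by simp
  next
    case 2
    then have "b i = 0" if "i < m" for i
      using that by (simp add: T_def sum_nonneg_eq_0_iff)
    then show ?thesis
      using distr_scaled_std_gaussian_vector[OF G \<open>b m \<noteq> 0\<close>] by simp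
  next
    case 3
    define S where "S = (\<lambda>\<omega>. \<Sum>i<m. b i *\<^sub>R G i \<omega>)"
    have [measurable]: "S \<in> borel_measurable M"
      unfolding S_def by measurable
    have distr_S: "distr M borel S = isotropic_gaussian (sqrt T)"
      using Suc.IH 3 by (simp add: S_def T_def)
    interpret S: prob_space "distr M borel S"
      by (rule prob_space_distr) simp
    have indep_S: "indep_var borel (G m) borel S"
      unfolding S_def by (rule indep_vars_sum_scaleR[OF indep])
    show ?thesis
    proof (rule measure_eqI)
      fix A assume "A \<in> sets (distr M borel (\<lambda>\<omega>. \<Sum>i<Suc m. b i *\<^sub>R G i \<omega>))"
      then have [measurable]: "A \<in> sets borel" by simp
      have "emeasure (distr M borel (\<lambda>\<omega>. \<Sum>i<Suc m. b i *\<^sub>R G i \<omega>)) A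
          = (\<integral>\<^sup>+\<omega>. indicator A (b m *\<^sub>R G m \<omega> + S \<omega>) \<partial>M)"
        by (subst emeasure_distr_nn_integral) (auto simp: S_def add.commute)
      also have "\<dots> = (\<integral>\<^sup>+\<omega>. \<integral>\<^sup>+\<omega>'. indicator A (b m *\<^sub>R G m \<omega> + S \<omega>') \<partial>M \<partial>M)"
        by (rule nn_integral_indep_var[OF indep_S]) measurable
      also have "\<dots> = (\<integral>\<^sup>+\<omega>. \<integral>\<^sup>+y. indicator A (b m *\<^sub>R G m \<omega> + y) \<partial>distr M borel S \<partial>M)"
        by (simp add: nn_integral_distr)
      also have "\<dots> = (\<integral>\<^sup>+x. \<integral>\<^sup>+y. indicator A (x + y) \<partial>isotropic_gaussian (sqrt T) \<partial>distr M borel (\<lambda>\<omega>. b m *\<^sub>R G m \<omega>))"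
        unfolding distr_S[symmetric] by (rule nn_integral_distr[symmetric]) measurable
      also have "\<dots> = (\<integral>\<^sup>+x. \<integral>\<^sup>+y. indicator A (x + y) \<partial>isotropic_gaussian (sqrt T) \<partial>isotropic_gaussian \<bar>b m\<bar>)"
        by (simp only: distr_scaled_std_gaussian_vector[OF G \<open>b m \<noteq> 0\<close>])
      also have "\<dots> = (\<integral>\<^sup>+z. indicator A z \<partial>isotropic_gaussian (sqrt (\<bar>b m\<bar>\<^sup>2 + (sqrt T)\<^sup>2)))"
        using 3 by (intro isotropic_gaussian_convolution) auto
      also have "\<dots> = emeasure (isotropic_gaussian (sqrt (\<Sum>i<Suc m. (b i)\<^sup>2))) A"
        using 3 by (simp add: T_def add.commute)
      finally show "emeasure (distr M borel (\<lambda>\<omega>. \<Sum>i<Suc m. b i *\<^sub>R G i \<omega>)) A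
          = emeasure (isotropic_gaussian (sqrt (\<Sum>i<Suc m. (b i)\<^sup>2))) A" .
    qed simp
  qed
qed simp

text \<open>The base point v is arbitrary in the induction so that it can absorb whichever summands
  are momentarily frozen.\<close>

lemma hinge_moment_comparison:
  fixes X G :: "nat \<Rightarrow> 'a \<Rightarrow> real^'d" and v :: "real^'d"
  assumes [measurable]: "\<And>i. X i \<in> borel_measurable M"
    and X: "indep_vars (\<lambda>_. borel) X UNIV" "\<And>i. rot_invariant M (X i)"
      "\<And>i. AE \<omega> in M. norm (X i \<omega>) \<le> 1"
    and G: "indep_vars (\<lambda>_. borel) G UNIV" "\<And>i. std_gaussian_vector M (G i)"
  shows "(\<integral>\<^sup>+\<omega>. ennreal (max 0 ((norm (v + (\<Sum>i<m. a i *\<^sub>R X i \<omega>)))\<^sup>2 - u) ^ 5) \<partial>M)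
    \<le> (\<integral>\<^sup>+\<omega>. ennreal (max 0 ((norm (v + (\<Sum>i<m. (a i * (1 / sqrt (real CARD('d)))) *\<^sub>R G i \<omega>)))\<^sup>2 - u) ^ 5) \<partial>M)"
proof (induction m arbitrary: v)
  case (Suc m)
  interpret MM: pair_sigma_finite M M ..
  have [measurable]: "G i \<in> borel_measurable M" for i
    using G by (simp add: std_gaussian_vector_def)
  define \<phi> where "\<phi> = (\<lambda>x::real^'d. ennreal (max 0 ((norm x)\<^sup>2 - u) ^ 5))"
  have [measurable]: "\<phi> \<in> borel_measurable borel"
    unfolding \<phi>_def by measurable
  define c where "c = 1 / sqrt (real CARD('d))"
  define S where "S = (\<lambda>\<omega>. \<Sum>i<m. a i *\<^sub>R X i \<omega>)"
  define T where "T = (\<lambda>\<omega>. \<Sum>i<m. (a i * c) *\<^sub>R G i \<omega>)"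
  have [measurable]: "S \<in> borel_measurable M" "T \<in> borel_measurable M"
    unfolding S_def T_def by measurable
  have IH: "(\<integral>\<^sup>+\<omega>. \<phi> (v + S \<omega>) \<partial>M) \<le> (\<integral>\<^sup>+\<omega>. \<phi> (v + T \<omega>) \<partial>M)" for v
    using Suc.IH[of v] by (simp only: \<phi>_def S_def T_def c_def)
  have "(\<integral>\<^sup>+\<omega>. ennreal ((c * norm (G m \<omega>))\<^sup>2) \<partial>M) = ennreal (c\<^sup>2) * (\<integral>\<^sup>+\<omega>. ennreal ((norm (G m \<omega>))\<^sup>2) \<partial>M)"
    by (subst nn_integral_cmult[symmetric]) (auto simp: power_mult_distrib ennreal_mult')
  also have "\<dots> = 1"
    by (simp add: std_gaussian_vector_norm_squared[OF G(2)] ennreal_mult'[symmetric] c_def power_divide del: ennreal_of_nat_eq_real_of_nat)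
  finally have c2: "(\<integral>\<^sup>+\<omega>. ennreal ((c * norm (G m \<omega>))\<^sup>2) \<partial>M) = 1" .
  have step: "(\<integral>\<^sup>+\<omega>. \<phi> (v + a m *\<^sub>R X m \<omega>) \<partial>M) \<le> (\<integral>\<^sup>+\<omega>. \<phi> (v + (a m * c) *\<^sub>R G m \<omega>) \<partial>M)" for v
    unfolding \<phi>_def using X G c2
    by (intro hinge_moment_comparison_one_step)
      (auto simp: c_def intro: rot_invariant_std_gaussian_vector std_gaussian_vector_AE_nonzero)
  have "(\<integral>\<^sup>+\<omega>. \<phi> (v + (S \<omega> + a m *\<^sub>R X m \<omega>)) \<partial>M) = (\<integral>\<^sup>+\<omega>. \<integral>\<^sup>+\<omega>'. \<phi> (v + (S \<omega>' + a m *\<^sub>R X m \<omega>)) \<partial>M \<partial>M)"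
    using indep_vars_sum_scaleR[OF X(1), of m a, folded S_def]
    by (rule nn_integral_indep_var) measurable
  also have "\<dots> \<le> (\<integral>\<^sup>+\<omega>. \<integral>\<^sup>+\<omega>'. \<phi> (v + (T \<omega>' + a m *\<^sub>R X m \<omega>)) \<partial>M \<partial>M)"
    \<comment> \<open>The last summand is frozen at \<omega> and joins the base point; after Fubini
      the Gaussian partial sum takes that place and the last summand is exchanged.\<close>
    using IH[of "v + a m *\<^sub>R X m \<omega>" for \<omega>] by (auto simp: add_ac intro: nn_integral_mono)
  also have "\<dots> = (\<integral>\<^sup>+\<omega>'. \<integral>\<^sup>+\<omega>. \<phi> (v + (T \<omega>' + a m *\<^sub>R X m \<omega>)) \<partial>M \<partial>M)"
    by (rule MM.Fubini') measurable
  also have "\<dots> \<le> (\<integral>\<^sup>+\<omega>'. \<integral>\<^sup>+\<omega>. \<phi> (v + (T \<omega>' + (a m * c) *\<^sub>R G m \<omega>)) \<partial>M \<partial>M)"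
    using step[of "v + T \<omega>" for \<omega>] by (auto simp: add_ac intro: nn_integral_mono)
  also have "\<dots> = (\<integral>\<^sup>+\<omega>. \<integral>\<^sup>+\<omega>'. \<phi> (v + (T \<omega>' + (a m * c) *\<^sub>R G m \<omega>)) \<partial>M \<partial>M)"
    by (rule MM.Fubini') measurable
  also have "\<dots> = (\<integral>\<^sup>+\<omega>. \<phi> (v + (T \<omega> + (a m * c) *\<^sub>R G m \<omega>)) \<partial>M)"
    using indep_vars_sum_scaleR[OF G(1), of m "\<lambda>i. a i * c", folded T_def]
    by (rule nn_integral_indep_var[symmetric]) measurable
  finally show ?case
    by (simp add: \<phi>_def S_def T_def c_def)
qed simp

end

theorem theorem2:
  fixes M :: "'a measure"
    and X G :: "nat \<Rightarrow> 'a \<Rightarrow> real^'d"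
    and a :: "nat \<Rightarrow> real" and m :: nat and t :: real
  assumes "prob_space M"
    and "\<And>i. X i \<in> borel_measurable M"
    and "prob_space.indep_vars M (\<lambda>_. borel) X UNIV"
    and "\<And>i. rot_invariant M (X i)"
    and "\<And>i. AE \<omega> in M. norm (X i \<omega>) \<le> 1"
    and "prob_space.indep_vars M (\<lambda>_. borel) G UNIV"
    and "\<And>i. std_gaussian_vector M (G i)"
    and "m \<ge> 1" and "t > 0"
  shows "measure M {\<omega> \<in> space M. norm (\<Sum>i<m. a i *\<^sub>R X i \<omega>) > t}
    \<le> 397 * measure M {\<omega> \<in> space M.
          norm (\<Sum>i<m. a i *\<^sub>R ((1 / sqrt (real CARD('d))) *\<^sub>R G i \<omega>)) > t}"
proof -
  interpret prob_space M by fact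
  note [measurable] = assms(2)
  have [measurable]: "G i \<in> borel_measurable M" for i
    using assms(7) by (simp add: std_gaussian_vector_def)
  define b where "b = (\<lambda>i. a i * (1 / sqrt (real CARD('d))))"
  define S where "S = (\<lambda>\<omega>. \<Sum>i<m. a i *\<^sub>R X i \<omega>)"
  define T where "T = (\<lambda>\<omega>. \<Sum>i<m. b i *\<^sub>R G i \<omega>)"
  have [measurable]: "S \<in> borel_measurable M" "T \<in> borel_measurable M"
    unfolding S_def T_def by measurable
  have T_eq: "(\<Sum>i<m. a i *\<^sub>R ((1 / sqrt (real CARD('d))) *\<^sub>R G i \<omega>)) = T \<omega>" for \<omega>
    by (simp add: T_def b_def)
  have sq: "norm x > t \<longleftrightarrow> (norm x)\<^sup>2 > t\<^sup>2" for x :: "real^'d"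
    using \<open>t > 0\<close> by (auto intro: power_strict_mono power_less_imp_less_base)
  define PS PT where "PS = prob {\<omega> \<in> space M. (norm (S \<omega>))\<^sup>2 > t\<^sup>2}"
    and "PT = prob {\<omega> \<in> space M. (norm (T \<omega>))\<^sup>2 > t\<^sup>2}"
  have "PS \<le> 397 * PT"
  proof (cases "\<forall>i<m. a i = 0")
    \<comment> \<open>With all coefficients zero the Gaussian sum is degenerate, but the event on
      the left is empty since t is positive.\<close>
    case True
    then have "{\<omega> \<in> space M. (norm (S \<omega>))\<^sup>2 > t\<^sup>2} = {}"
      by (auto simp: S_def)
    then have "PS = 0"
      unfolding PS_def by (simp only: measure_empty)
    then show ?thesis
      by (simp add: PT_def)
  next
    case False
    then obtain i where i: "i < m" "b i \<noteq> 0"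
      by (auto simp: b_def)
    then have "(\<Sum>i<m. (b i)\<^sup>2) > 0"
      by (intro sum_pos2[of _ i]) auto
    then obtain s where s: "s > 0" and distr_T: "distr M borel T = isotropic_gaussian s"
      using distr_sum_std_gaussian_vectors[OF assms(6,7), of b m] unfolding T_def by (metis real_sqrt_gt_zero)
    have PT: "emeasure (isotropic_gaussian s) {x::real^'d. (norm x)\<^sup>2 > t\<^sup>2} = ennreal PT"
      unfolding distr_T[symmetric] PT_def
      by (subst emeasure_distr) (auto simp: emeasure_eq_measure vimage_def Int_def conj_commute)
    have "t\<^sup>2 > 0"
      using \<open>t > 0\<close> by simp
    from isotropic_gaussian_hinge_tail[OF s this, where 'a = "real^'d"] show ?thesis
      unfolding PT
    proof
      assume "emeasure (isotropic_gaussian s :: (real^'d) measure) UNIV \<le> 397 * ennreal PT"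
      moreover have "emeasure (isotropic_gaussian s :: (real^'d) measure) UNIV = 1"
        unfolding distr_T[symmetric] by (subst emeasure_distr) (auto simp: emeasure_space_1)
      ultimately have "ennreal 1 \<le> ennreal (397 * PT)"
        by (simp add: ennreal_mult')
      then have "1 \<le> 397 * PT"
        by (subst (asm) ennreal_le_iff) (auto simp: PT_def)
      moreover have "PS \<le> 1"
        by (simp add: PS_def)
      ultimately show ?thesis
        by linarith
    next
      assume "\<exists>u<t\<^sup>2. (\<integral>\<^sup>+x. ennreal (max 0 ((norm x)\<^sup>2 - u) ^ 5) \<partial>(isotropic_gaussian s :: (real^'d) measure))
        \<le> ennreal (397 * (t\<^sup>2 - u) ^ 5) * ennreal PT"
      then obtain u where u: "u < t\<^sup>2"
        and tail: "(\<integral>\<^sup>+x. ennreal (max 0 ((norm x)\<^sup>2 - u) ^ 5) \<partial>(isotropic_gaussian s :: (real^'d) measure))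
          \<le> ennreal (397 * (t\<^sup>2 - u) ^ 5) * ennreal PT"
        by blast
      have pos: "(t\<^sup>2 - u) ^ 5 > 0"
        using u by simp
      have "ennreal ((t\<^sup>2 - u) ^ 5 * PS) = (\<integral>\<^sup>+\<omega>. ennreal ((t\<^sup>2 - u) ^ 5) * indicator {\<omega> \<in> space M. (norm (S \<omega>))\<^sup>2 > t\<^sup>2} \<omega> \<partial>M)"
        using pos by (subst nn_integral_cmult_indicator) (auto simp: PS_def emeasure_eq_measure ennreal_mult')
      also have "\<dots> \<le> (\<integral>\<^sup>+\<omega>. ennreal (max 0 ((norm (0 + S \<omega>))\<^sup>2 - u) ^ 5) \<partial>M)"
        \<comment> \<open>Markov's inequality: on the event the hinge exceeds t^2 - u, which is
          positive.\<close>
        using u by (intro nn_integral_mono) (auto split: split_indicator intro!: ennreal_leI power_mono)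
      also have "\<dots> \<le> (\<integral>\<^sup>+\<omega>. ennreal (max 0 ((norm (0 + T \<omega>))\<^sup>2 - u) ^ 5) \<partial>M)"
        unfolding S_def T_def b_def by (rule hinge_moment_comparison[OF assms(2-7)])
      also have "\<dots> = (\<integral>\<^sup>+x. ennreal (max 0 ((norm x)\<^sup>2 - u) ^ 5) \<partial>distr M borel T)"
        by (subst nn_integral_distr) auto
      also have "\<dots> \<le> ennreal (397 * (t\<^sup>2 - u) ^ 5 * PT)"
        using tail pos by (simp add: distr_T ennreal_mult')
      finally have "(t\<^sup>2 - u) ^ 5 * PS \<le> 397 * (t\<^sup>2 - u) ^ 5 * PT"
        using pos by (subst (asm) ennreal_le_iff) (auto simp: PT_def)
      then have "(t\<^sup>2 - u) ^ 5 * PS \<le> (t\<^sup>2 - u) ^ 5 * (397 * PT)"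
        by (simp add: mult_ac)
      then show ?thesis
        using pos by (simp only: mult_le_cancel_left_pos)
    qed
  qed
  then show ?thesis
    unfolding T_eq sq PS_def PT_def S_def .
qed

end
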